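(* There exists an absolute constant $C$ such that for every $n$, every $1\leqslant d\leqslant n$, every centered convex body $K\subseteq\mathbb{R}^n$ and every $d$-dimensional linear subspace $H$ of $\mathbb{R}^n$ there exists an orthonormal basis $\{w_j\}_{j=1}^d$ of $H$ such that $$|K|\,|K\cap H^\perp|^{d-1}\leqslant C^{d(d-1)}d^{\frac d2}\prod_{j=1}^d|K\cap (H^\perp\oplus\langle w_j\rangle)|.$$
   Context: A convex body in $\mathbb{R}^n$ is a compact convex set with non-empty interior. $|\cdot|$ denotes volume (Lebesgue measure) in the corresponding subspace (with $|\{0\}|=1$ in dimension $0$). $K$ is centered if its barycentre $\frac{1}{|K|}\int_K x\,dx$ equals $0$. $H^\perp$ is the orthogonal complement of $H$, and $\langle w_j\rangle$ is the line spanned by $w_j$. "Absolute constant" means a constant independent of $n$, $d$, $K$ and $H$. *)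

theory Defs
  imports "HOL-Analysis.Analysis"
begin

text \<open>
  The constant of the theorem must not depend on the dimension, so the dimension has to be
  quantified inside the formula and cannot be the index type of \<^typ>\<open>real ^ 'n\<close>. All the spaces
  \<open>\<real>\<^sup>n\<close> are therefore realised as coordinate subspaces of one inner product space, the finitely
  supported real sequences with the standard inner product.
\<close>

typedef fseq = "{f :: nat \<Rightarrow> real. finite {i. f i \<noteq> 0}}"
  morphisms coord Abs_fseq
  by (rule exI [of _ "\<lambda>_. 0"]) simp

setup_lifting type_definition_fseq

lemma finite_coord: "finite {i. coord x i \<noteq> 0}"
  using coord [of x] by simp

lemma fseq_eqI: "(\<And>i. coord x i = coord y i) \<Longrightarrow> x = y"
  by (simp add: coord_inject [symmetric] fun_eq_iff)

instantiation fseq :: real_vector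
begin

lift_definition zero_fseq :: fseq is "\<lambda>_. 0" by simp

lift_definition plus_fseq :: "fseq \<Rightarrow> fseq \<Rightarrow> fseq" is "\<lambda>f g i. f i + g i"
  by (erule (1) finite_subset [OF _ finite_UnI, rotated]) auto

lift_definition uminus_fseq :: "fseq \<Rightarrow> fseq" is "\<lambda>f i. - f i" by simp

lift_definition minus_fseq :: "fseq \<Rightarrow> fseq \<Rightarrow> fseq" is "\<lambda>f g i. f i - g i"
  by (erule (1) finite_subset [OF _ finite_UnI, rotated]) auto

lift_definition scaleR_fseq :: "real \<Rightarrow> fseq \<Rightarrow> fseq" is "\<lambda>r f i. r * f i"
  by (rule finite_subset [rotated]) auto

instance
  by standard (transfer; simp add: fun_eq_iff algebra_simps)+

end

lemmas coord_simps [simp] =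
  zero_fseq.rep_eq plus_fseq.rep_eq uminus_fseq.rep_eq minus_fseq.rep_eq scaleR_fseq.rep_eq

instantiation fseq :: real_inner
begin

definition inner_fseq :: "fseq \<Rightarrow> fseq \<Rightarrow> real" where
  "inner_fseq x y = (\<Sum>i | coord x i \<noteq> 0. coord x i * coord y i)"

definition norm_fseq :: "fseq \<Rightarrow> real" where
  "norm_fseq x = sqrt (inner x x)"

definition dist_fseq :: "fseq \<Rightarrow> fseq \<Rightarrow> real" where
  "dist_fseq x y = norm (x - y)"

definition sgn_fseq :: "fseq \<Rightarrow> fseq" where
  "sgn_fseq x = x /\<^sub>R norm x"

definition uniformity_fseq :: "(fseq \<times> fseq) filter" where
  "uniformity_fseq = (INF e\<in>{0<..}. principal {(x, y). dist x y < e})"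

definition open_fseq :: "fseq set \<Rightarrow> bool" where
  "open_fseq U \<longleftrightarrow> (\<forall>x\<in>U. \<forall>\<^sub>F (x', y) in uniformity. x' = x \<longrightarrow> y \<in> U)"

lemma inner_fseq_superset:
  assumes "finite S" and "{i. coord x i \<noteq> 0} \<subseteq> S"
  shows "inner x y = (\<Sum>i\<in>S. coord x i * coord y i)"
  unfolding inner_fseq_def using assms by (intro sum.mono_neutral_left) auto

instance
proof
  fix x y z :: fseq and r :: real
  define S where "S = {i. coord x i \<noteq> 0} \<union> {i. coord y i \<noteq> 0}"
  have S: "finite S" "{i. coord x i \<noteq> 0} \<subseteq> S" "{i. coord y i \<noteq> 0} \<subseteq> S"
    "{i. coord (x + y) i \<noteq> 0} \<subseteq> S" "{i. coord (r *\<^sub>R x) i \<noteq> 0} \<subseteq> S"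
    by (auto simp: S_def finite_coord)
  show "inner x y = inner y x"
    using S by (simp add: inner_fseq_superset [of S] mult.commute)
  show "inner (x + y) z = inner x z + inner y z"
    using S by (simp add: inner_fseq_superset [of S] sum.distrib algebra_simps)
  show "inner (r *\<^sub>R x) y = r * inner x y"
    using S by (simp add: inner_fseq_superset [of S] sum_distrib_left algebra_simps)
  show "0 \<le> inner x x"
    by (simp add: inner_fseq_def sum_nonneg)
  show "inner x x = 0 \<longleftrightarrow> x = 0"
  proof
    assume "inner x x = 0"
    then have "\<forall>i\<in>{i. coord x i \<noteq> 0}. coord x i * coord x i = 0"
      using finite_coord [of x] by (subst (asm) inner_fseq_def, subst (asm) sum_nonneg_eq_0_iff) auto
    then show "x = 0"
      by (auto intro: fseq_eqI)
  qed (simp add: inner_fseq_def)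
qed (fact dist_fseq_def sgn_fseq_def uniformity_fseq_def open_fseq_def norm_fseq_def)+

end

lift_definition axis_fseq :: "nat \<Rightarrow> fseq" is "\<lambda>i j. if j = i then 1 else 0"
  by simp

text \<open>\<open>\<real>\<^sup>n\<close>\<close>

definition Rn :: "nat \<Rightarrow> fseq set" where
  "Rn n = {x. \<forall>i\<ge>n. coord x i = 0}"

definition orthonormal_basis :: "'a::real_inner set \<Rightarrow> 'a set \<Rightarrow> bool" where
  "orthonormal_basis B V \<longleftrightarrow> pairwise orthogonal B \<and> (\<forall>b\<in>B. norm b = 1) \<and> span B = V"

text \<open>
  Lebesgue measure in a finite-dimensional subspace \<open>V\<close>, built from an orthonormal basis in the
  same way as \<^const>\<open>lborel\<close> is built from \<^const>\<open>Basis\<close>. By rotation invariance of Lebesgue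
  measure the choice of the basis is irrelevant. For \<open>V = {0}\<close> it is the unit mass at \<open>0\<close>.
\<close>

definition lborel_of :: "'a::real_inner set \<Rightarrow> 'a measure" where
  "lborel_of V = (let B = (SOME B. orthonormal_basis B V) in
     distr (\<Pi>\<^sub>M b\<in>B. lborel) borel (\<lambda>x. \<Sum>b\<in>B. x b *\<^sub>R b))"

definition section_volume :: "'a::real_inner set \<Rightarrow> 'a set \<Rightarrow> real" where
  "section_volume K V = measure (lborel_of V) (K \<inter> V)"

definition convex_body :: "nat \<Rightarrow> fseq set \<Rightarrow> bool" where
  "convex_body n K \<longleftrightarrow>
     K \<subseteq> Rn n \<and> compact K \<and> convex K \<and> top_of_set (Rn n) interior_of K \<noteq> {}"

text \<open>The vector-valued integral \<open>\<integral>\<^sub>K x dx\<close> is taken coordinatewise.\<close>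

definition barycentre :: "nat \<Rightarrow> fseq set \<Rightarrow> fseq" where
  "barycentre n K = (1 / measure (lborel_of (Rn n)) K) *\<^sub>R
     (\<Sum>i<n. (LINT x:K|lborel_of (Rn n). coord x i) *\<^sub>R axis_fseq i)"

definition centered :: "nat \<Rightarrow> fseq set \<Rightarrow> bool" where
  "centered n K \<longleftrightarrow> barycentre n K = 0"

text \<open>The orthogonal complement of \<open>H\<close> relative to \<open>\<real>\<^sup>n\<close>.\<close>

definition orth_in :: "nat \<Rightarrow> fseq set \<Rightarrow> fseq set" where
  "orth_in n H = H\<^sup>\<bottom> \<inter> Rn n"

end

theory Submission
  imports Defs "HOL-Probability.Distributions"
begin

text \<open>
  Let \<open>f x = |K \<inter> (H\<^sup>\<bottom> + x)|\<close> for \<open>x \<in> H\<close>. By Fubini the integral of \<open>f\<close> over \<open>H\<close> is \<open>|K|\<close>,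
  the integral of \<open>f\<close> over the line spanned by \<open>w\<close> is the volume of the section of \<open>K\<close> by
  \<open>H\<^sup>\<bottom> \<oplus> \<langle>w\<rangle>\<close>, and \<open>f 0 = |K \<inter> H\<^sup>\<bottom>|\<close>. The inequality is thus a statement about one function on
  a \<open>d\<close>-dimensional space, and \<open>n\<close> has disappeared. Two properties of \<open>f\<close> carry the proof:
  \<open>f x * f y \<le> f ((x + y) / 2)\<^sup>2\<close>, which is Brunn-Minkowski in multiplicative form
  (\<open>brunn_minkowski_midpoint\<close>, from \<open>prekopa_leindler\<close>), and the fact that half-spaces whose
  boundary is close to the barycentre have a fixed fraction of the mass (\<open>centered_log_concave_tail\<close>).

  The basis. Let \<open>N u\<close> be the mean of \<open>|x \<bullet> u|\<close> over \<open>K\<close>, a norm on \<open>H\<close>. Choose \<open>w\<^sub>1\<close> to maximise \<open>N\<close>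
  on the unit sphere of \<open>H\<close>, then \<open>w\<^sub>2\<close> on the unit sphere of the orthogonal complement of \<open>w\<^sub>1\<close>,
  and so on. Then \<open>|u \<bullet> w\<^sub>j| * N w\<^sub>j \<le> 2 ^ d * N u\<close> for all \<open>u \<in> H\<close>
  (\<open>seminorm_almost_diagonal_basis\<close>). The loss of \<open>2 ^ d\<close> in each of \<open>d\<close> directions is what the
  constant \<open>C ^ (d * (d - 1))\<close> can absorb.

  A lower bound for \<open>f\<close>. Let \<open>x = t * N w\<^sub>j * w\<^sub>j\<close> with \<open>|t| \<le> 1 / 2 ^ (d + 2)\<close>, so that
  \<open>x \<bullet> u \<le> N u / 4\<close> for all \<open>u\<close>. If \<open>f x < s\<close>, then \<open>x\<close> is separated from the compact convex set
  \<open>{f \<ge> s}\<close> by some \<open>u\<close>, and \<open>f < s\<close> on the half-space \<open>{y. y \<bullet> u \<ge> N u / 4}\<close>. This half-space contains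
  at least \<open>1/16\<close> of the mass. By Markov's inequality at most \<open>1/32\<close> of the mass lies outside the box
  \<open>|y \<bullet> w\<^sub>i| \<le> 32 * d * N w\<^sub>i\<close>, so the half-space and the box share at least \<open>1/32\<close>. Comparison with the volume of the box gives
  \<open>f x \<ge> s\<^sub>0 = |K| / (64 * (64 * d) ^ d * \<Prod> N w\<^sub>i)\<close> (\<open>fibre_volume_lower\<close>).

  Conclusion. Log-concavity on the segment from \<open>0\<close> to \<open>x\<close> yields
  \<open>f (x / 2 ^ d) \<ge> f 0 * (s\<^sub>0 / f 0) powr (1 / 2 ^ d)\<close>, so each section has volume at least
  \<open>N w\<^sub>j / 2 ^ (2 * d + 1) * f 0 * (s\<^sub>0 / f 0) powr (1 / 2 ^ d)\<close>. In the product of these \<open>d\<close> bounds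
  the last factors contribute at least \<open>s\<^sub>0 / f 0\<close>, because \<open>d \<le> 2 ^ d\<close>, and the \<open>N w\<^sub>j\<close> cancel
  against those in \<open>s\<^sub>0\<close>. What remains is \<open>|K| * f 0 ^ (d - 1)\<close> up to a factor that for \<open>d \<ge> 2\<close> is at
  most \<open>(2 ^ 15) ^ (d * (d - 1))\<close>. For \<open>d = 1\<close> the section by \<open>H\<^sup>\<bottom> \<oplus> H\<close> is \<open>K\<close> itself.
\<close>

section \<open>Coordinates and separability of the sequence space\<close>

lemma coord_sum: "coord (sum f A) i = (\<Sum>a\<in>A. coord (f a) i)"
  by (induction A rule: infinite_finite_induct) auto

lemma coord_axis_fseq [simp]: "coord (axis_fseq i) j = (if j = i then 1 else 0)"
  by (simp add: axis_fseq.rep_eq)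

lemma inner_axis_fseq [simp]: "x \<bullet> axis_fseq i = coord x i"
  by (subst inner_commute, subst inner_fseq_superset[of "{i}"]) auto

lemma norm_axis_fseq [simp]: "norm (axis_fseq i) = 1"
  by (simp add: norm_eq_sqrt_inner)

lemma Rn_eq_sum_axis: "x \<in> Rn n \<longleftrightarrow> x = (\<Sum>i<n. coord x i *\<^sub>R axis_fseq i)"
proof
  assume "x \<in> Rn n"
  then show "x = (\<Sum>i<n. coord x i *\<^sub>R axis_fseq i)"
    by (intro fseq_eqI) (auto simp: coord_sum Rn_def if_distrib cong: if_cong)
next
  assume x: "x = (\<Sum>i<n. coord x i *\<^sub>R axis_fseq i)"
  show "x \<in> Rn n"
    by (subst x) (auto simp: Rn_def coord_sum intro!: sum.neutral)
qed

lemma in_some_Rn: "\<exists>n. x \<in> Rn n"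
proof -
  obtain n where "{i. coord x i \<noteq> 0} \<subseteq> {..<n}"
    using finite_nat_iff_bounded finite_coord by blast
  then show ?thesis by (intro exI[of _ n]) (fastforce simp: Rn_def)
qed

lemma span_axes: "span (axis_fseq ` {..<n}) = Rn n"
proof (intro equalityI subsetI)
  have "subspace (Rn n)" by (auto simp: subspace_def Rn_def)
  moreover have "axis_fseq ` {..<n} \<subseteq> Rn n" by (auto simp: Rn_def)
  ultimately show "x \<in> Rn n" if "x \<in> span (axis_fseq ` {..<n})" for x
    using that span_minimal by blast
next
  fix x assume "x \<in> Rn n"
  then have "x = (\<Sum>i<n. coord x i *\<^sub>R axis_fseq i)" by (simp add: Rn_eq_sum_axis)
  also have "\<dots> \<in> span (axis_fseq ` {..<n})"
    by (intro span_sum span_scale span_base) auto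
  finally show "x \<in> span (axis_fseq ` {..<n})" .
qed

text \<open>Balls of radius \<open>1 / (k + 1)\<close> around finitely supported rational sequences form a countable basis.
  Second countability makes sums of Borel functions into \<^typ>\<open>fseq\<close> Borel, so that the map defining
  \<^const>\<open>lborel_of\<close> is measurable.\<close>

instance fseq :: second_countable_topology
proof
  define q where "q = (\<lambda>rs :: rat list. \<Sum>i<length rs. of_rat (rs ! i) *\<^sub>R axis_fseq i)"
  have dense: "\<exists>rs. dist (q rs) x < e" if "e > 0" for x e
  proof -
    obtain n where n: "x \<in> Rn n" using in_some_Rn by blast
    have "\<exists>r. \<bar>of_rat r - coord x i\<bar> < e / Suc n" for i
    proof -
      obtain r where "coord x i - e / Suc n < of_rat r" "of_rat r < coord x i"
        using of_rat_dense[of "coord x i - e / Suc n" "coord x i"] \<open>e > 0\<close> by auto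
      then show ?thesis by (intro exI[of _ r]) auto
    qed
    then obtain r where r: "\<bar>of_rat (r i) - coord x i\<bar> < e / Suc n" for i by metis
    have "(\<Sum>i<n. coord x i *\<^sub>R axis_fseq i) = x"
      using n Rn_eq_sum_axis by metis
    then have "q (map r [0..<n]) - x = (\<Sum>i<n. (of_rat (r i) - coord x i) *\<^sub>R axis_fseq i)"
      by (simp add: q_def scaleR_diff_left sum_subtractf)
    also have "norm \<dots> \<le> (\<Sum>i<n. \<bar>of_rat (r i) - coord x i\<bar>)"
      by (rule order_trans[OF norm_sum]) simp
    also have "\<dots> \<le> (\<Sum>i<n. e / Suc n)"
      using r by (intro sum_mono) (simp add: less_imp_le)
    also have "\<dots> < e" using \<open>e > 0\<close> by (simp add: field_simps)
    finally show ?thesis by (auto simp: dist_norm)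
  qed
  define BB where "BB = (\<lambda>(rs, k). ball (q rs) (1 / Suc k)) ` UNIV"
  have "topological_basis BB"
  proof (rule topological_basisI)
    show "open B" if "B \<in> BB" for B using that by (auto simp: BB_def)
    fix U :: "fseq set" and x assume U: "open U" "x \<in> U"
    then obtain e where e: "e > 0" "ball x e \<subseteq> U" using open_contains_ball by blast
    obtain k where k: "1 / real (Suc k) < e / 2"
      using e by (meson half_gt_zero nat_approx_posE)
    obtain rs where rs: "dist (q rs) x < 1 / Suc k" using dense by (meson of_nat_0_less_iff zero_less_Suc zero_less_divide_1_iff)
    have "ball (q rs) (1 / Suc k) \<subseteq> ball x e"
    proof
      fix y assume "y \<in> ball (q rs) (1 / Suc k)"
      then have "dist x y < 1 / Suc k + 1 / Suc k"
        using rs dist_triangle[of x y "q rs"] by (simp add: dist_commute)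
      then show "y \<in> ball x e" using k by simp
    qed
    then show "\<exists>B'\<in>BB. x \<in> B' \<and> B' \<subseteq> U"
      using e rs unfolding BB_def by (intro bexI[of _ "ball (q rs) (1 / Suc k)"]) auto
  qed
  moreover have "countable BB" unfolding BB_def by simp
  ultimately show "\<exists>B::fseq set set. countable B \<and> open = generate_topology B"
    using topological_basis_imp_subbasis by blast
qed

section \<open>Orthonormal systems and the Lebesgue measure of their span\<close>

definition orthonormal :: "'a::real_inner set \<Rightarrow> bool" where
  "orthonormal B \<longleftrightarrow> finite B \<and> pairwise orthogonal B \<and> (\<forall>b\<in>B. norm b = 1)"

lemma orthonormal_inner:
  assumes "orthonormal B" "b \<in> B" "c \<in> B"
  shows "b \<bullet> c = (if b = c then 1 else 0)"
  using assms by (auto simp: orthonormal_def pairwise_def orthogonal_def dot_square_norm)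

lemma orthonormal_finite [simp]: "orthonormal B \<Longrightarrow> finite B"
  by (simp add: orthonormal_def)

lemma orthonormal_subset: "orthonormal B \<Longrightarrow> A \<subseteq> B \<Longrightarrow> orthonormal A"
  by (auto simp: orthonormal_def pairwise_def intro: finite_subset)

lemma inner_sum_orthonormal:
  assumes "orthonormal B" "c \<in> B"
  shows "(\<Sum>b\<in>B. x b *\<^sub>R b) \<bullet> c = x c"
proof -
  have "(\<Sum>b\<in>B. x b *\<^sub>R b) \<bullet> c = (\<Sum>b\<in>B. if c = b then x b else 0)"
    using orthonormal_inner[OF assms(1) _ assms(2)]
    by (simp add: inner_sum_left) (intro sum.cong, auto)
  then show ?thesis using assms by simp
qed

lemma span_orthonormal:
  assumes "orthonormal B"
  shows "x \<in> span B \<longleftrightarrow> x = (\<Sum>b\<in>B. (x \<bullet> b) *\<^sub>R b)"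
proof
  assume "x \<in> span B"
  then obtain c where x: "x = (\<Sum>b\<in>B. c b *\<^sub>R b)"
    using assms by (auto simp: span_finite)
  then show "x = (\<Sum>b\<in>B. (x \<bullet> b) *\<^sub>R b)"
    using inner_sum_orthonormal[OF assms, of _ c] by (metis (no_types, lifting) sum.cong)
next
  assume "x = (\<Sum>b\<in>B. (x \<bullet> b) *\<^sub>R b)"
  also have "\<dots> \<in> span B" by (intro span_sum span_scale span_base)
  finally show "x \<in> span B" .
qed

lemma closed_span_orthonormal:
  assumes "orthonormal B" shows "closed (span B)"
proof -
  have "span B = {x. x = (\<Sum>b\<in>B. (x \<bullet> b) *\<^sub>R b)}"
    using span_orthonormal[OF assms] by blast
  then show ?thesis by (simp add: closed_Collect_eq continuous_intros)
qed

lemma orthonormal_independent: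
  assumes "orthonormal B" shows "independent B"
  using assms by (intro pairwise_orthogonal_independent) (auto simp: orthonormal_def)

lemma orthonormal_card:
  assumes "orthonormal B" shows "card B = dim (span B)"
  using orthonormal_independent[OF assms] dim_eq_card[OF refl, of B] by simp

lemma norm_sum_orthonormal:
  assumes "orthonormal B"
  shows "(norm (\<Sum>b\<in>B. x b *\<^sub>R b))\<^sup>2 = (\<Sum>b\<in>B. (x b)\<^sup>2)"
  unfolding power2_norm_eq_inner
  using assms inner_sum_orthonormal[OF assms]
  by (subst inner_sum_right) (auto simp: power2_eq_square intro!: sum.cong)

text \<open>The measure behind \<^const>\<open>lborel_of\<close> for a prescribed basis. Keeping the basis explicit allows
  Fubini along a splitting of the basis; the dependence on the basis is removed afterwards.\<close>

definition basis_measure :: "'a::real_inner set \<Rightarrow> 'a measure" where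
  "basis_measure B = distr (\<Pi>\<^sub>M b\<in>B. lborel) borel (\<lambda>x. \<Sum>b\<in>B. x b *\<^sub>R b)"

lemma sets_basis_measure [simp, measurable_cong]: "sets (basis_measure B) = sets borel"
  by (simp add: basis_measure_def)

lemma space_basis_measure [simp]: "space (basis_measure B) = UNIV"
  by (simp add: basis_measure_def)

lemma measurable_linear_combination [measurable]:
  fixes B :: "'a::{real_inner,second_countable_topology} set"
  shows "(\<lambda>x. \<Sum>b\<in>B. x b *\<^sub>R b) \<in> borel_measurable (\<Pi>\<^sub>M b\<in>B. lborel)"
  by measurable

lemma nn_integral_basis_measure:
  fixes B :: "'a::{real_inner,second_countable_topology} set"
  assumes [measurable]: "h \<in> borel_measurable borel"
  shows "(\<integral>\<^sup>+x. h x \<partial>basis_measure B) =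
    (\<integral>\<^sup>+x. h (\<Sum>b\<in>B. x b *\<^sub>R b) \<partial>(\<Pi>\<^sub>M b\<in>B. lborel))"
  by (simp add: basis_measure_def nn_integral_distr)

interpretation lborel_family: product_sigma_finite "\<lambda>_. lborel :: real measure"
  by standard

lemma nn_integral_basis_measure_empty:
  fixes h :: "'a::{real_inner,second_countable_topology} \<Rightarrow> ennreal"
  assumes [measurable]: "h \<in> borel_measurable borel"
  shows "(\<integral>\<^sup>+x. h x \<partial>basis_measure {}) = h 0"
  by (subst nn_integral_basis_measure, measurable) (simp add: PiM_empty nn_integral_count_space_finite)

lemma nn_integral_basis_measure_insert:
  fixes h :: "'a::{real_inner,second_countable_topology} \<Rightarrow> ennreal"
  assumes "finite B" "b \<notin> B" and [measurable]: "h \<in> borel_measurable borel"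
  shows "(\<integral>\<^sup>+x. h x \<partial>basis_measure (insert b B)) =
    (\<integral>\<^sup>+x. (\<integral>\<^sup>+t. h (t *\<^sub>R b + x) \<partial>lborel) \<partial>basis_measure B)"
proof -
  have "(\<integral>\<^sup>+x. h x \<partial>basis_measure (insert b B)) =
    (\<integral>\<^sup>+x. (\<integral>\<^sup>+t. h (\<Sum>c\<in>insert b B. (x(b := t)) c *\<^sub>R c) \<partial>lborel) \<partial>(\<Pi>\<^sub>M b\<in>B. lborel))"
    unfolding nn_integral_basis_measure[OF assms(3)]
    by (rule lborel_family.product_nn_integral_insert[OF assms(1,2)]) measurable
  also have "\<dots> = (\<integral>\<^sup>+x. (\<integral>\<^sup>+t. h (t *\<^sub>R b + (\<Sum>c\<in>B. x c *\<^sub>R c)) \<partial>lborel) \<partial>(\<Pi>\<^sub>M b\<in>B. lborel))"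
    using assms(1,2) by (auto intro!: nn_integral_cong arg_cong[of _ _ h] sum.cong)
  also have "\<dots> = (\<integral>\<^sup>+x. (\<integral>\<^sup>+t. h (t *\<^sub>R b + x) \<partial>lborel) \<partial>basis_measure B)"
    by (subst nn_integral_basis_measure) measurable
  finally show ?thesis .
qed

lemma nn_integral_basis_measure_singleton:
  fixes h :: "'a::{real_inner,second_countable_topology} \<Rightarrow> ennreal"
  assumes [measurable]: "h \<in> borel_measurable borel"
  shows "(\<integral>\<^sup>+x. h x \<partial>basis_measure {b}) = (\<integral>\<^sup>+t. h (t *\<^sub>R b) \<partial>lborel)"
  by (simp add: nn_integral_basis_measure_insert nn_integral_basis_measure_empty)

lemma AE_basis_measure_span:
  fixes B :: "'a::{real_inner,second_countable_topology} set"
  assumes "orthonormal B"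
  shows "AE x in basis_measure B. x \<in> span B"
proof -
  have [measurable]: "span B \<in> sets borel"
    using closed_span_orthonormal[OF assms] by simp
  show ?thesis
    unfolding basis_measure_def
    by (subst AE_distr_iff) (auto intro!: AE_I2 span_sum span_scale intro: span_base)
qed

lemma emeasure_basis_measure_box:
  fixes B :: "'a::{real_inner,second_countable_topology} set"
  assumes "orthonormal B" "\<And>b. b \<in> B \<Longrightarrow> 0 \<le> r b"
  shows "emeasure (basis_measure B) {x. \<forall>b\<in>B. \<bar>x \<bullet> b\<bar> \<le> r b} = ennreal (\<Prod>b\<in>B. 2 * r b)"
proof -
  have fin: "finite B" using assms(1) by simp
  have m: "{x. \<forall>b\<in>B. \<bar>x \<bullet> b\<bar> \<le> r b} \<in> sets borel"
    using fin by measurable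
  have "emeasure (basis_measure B) {x. \<forall>b\<in>B. \<bar>x \<bullet> b\<bar> \<le> r b}
      = emeasure (\<Pi>\<^sub>M b\<in>B. lborel) (\<Pi>\<^sub>E b\<in>B. {- r b..r b})"
    unfolding basis_measure_def
  proof (subst emeasure_distr[OF _ m])
    show "(\<lambda>x. \<Sum>b\<in>B. x b *\<^sub>R b) \<in> (\<Pi>\<^sub>M b\<in>B. lborel) \<rightarrow>\<^sub>M borel" by measurable
    have "(\<lambda>x. \<Sum>b\<in>B. x b *\<^sub>R b) -` {x. \<forall>b\<in>B. \<bar>x \<bullet> b\<bar> \<le> r b} \<inter> space (\<Pi>\<^sub>M b\<in>B. lborel)
      = (\<Pi>\<^sub>E b\<in>B. {- r b..r b})"
      using assms(1) by (auto simp: space_PiM PiE_def inner_sum_orthonormal abs_le_iff Pi_iff) fastforce+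
    then show "emeasure (\<Pi>\<^sub>M b\<in>B. lborel) ((\<lambda>x. \<Sum>b\<in>B. x b *\<^sub>R b) -`
        {x. \<forall>b\<in>B. \<bar>x \<bullet> b\<bar> \<le> r b} \<inter> space (\<Pi>\<^sub>M b\<in>B. lborel)) =
      emeasure (\<Pi>\<^sub>M b\<in>B. lborel) (\<Pi>\<^sub>E b\<in>B. {- r b..r b})" by simp
  qed
  also have "\<dots> = (\<Prod>b\<in>B. emeasure lborel {- r b..r b})"
    using fin by (intro lborel_family.emeasure_PiM) auto
  also have "\<dots> = (\<Prod>b\<in>B. ennreal (2 * r b))"
    using assms(2) by (intro prod.cong) (auto simp: emeasure_lborel_Icc)
  also have "\<dots> = ennreal (\<Prod>b\<in>B. 2 * r b)"
    using assms(2) by (intro prod_ennreal) auto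
  finally show ?thesis .
qed

lemma sigma_finite_basis_measure:
  fixes B :: "'a::{real_inner,second_countable_topology} set"
  assumes "orthonormal B"
  shows "sigma_finite_measure (basis_measure B)"
proof
  define Q :: "nat \<Rightarrow> 'a set" where "Q n = {x. \<forall>b\<in>B. \<bar>x \<bullet> b\<bar> \<le> real n}" for n
  have m: "Q n \<in> sets borel" for n
    using orthonormal_finite[OF assms] unfolding Q_def by measurable
  have "emeasure (basis_measure B) (Q n) \<noteq> \<infinity>" for n
    using emeasure_basis_measure_box[OF assms, of "\<lambda>_. real n"] by (simp add: Q_def)
  moreover have "x \<in> (\<Union>n. Q n)" for x
  proof -
    obtain n where n: "(\<Sum>b\<in>B. \<bar>x \<bullet> b\<bar>) \<le> real n" using real_arch_simple by blast
    have "\<bar>x \<bullet> b\<bar> \<le> real n" if "b \<in> B" for b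
      using member_le_sum[OF that, of "\<lambda>b. \<bar>x \<bullet> b\<bar>"] assms n by fastforce
    then show ?thesis by (auto simp: Q_def)
  qed
  ultimately show "\<exists>A. countable A \<and> A \<subseteq> sets (basis_measure B) \<and> \<Union>A = space (basis_measure B) \<and>
        (\<forall>a\<in>A. emeasure (basis_measure B) a \<noteq> \<infinity>)"
    using m by (intro exI[of _ "range Q"]) auto
qed

lemma nn_integral_basis_measure_Un:
  fixes h :: "'a::{real_inner,second_countable_topology} \<Rightarrow> ennreal"
  assumes "orthonormal A" "orthonormal B" "A \<inter> B = {}" and h: "h \<in> borel_measurable borel"
  shows "(\<integral>\<^sup>+x. h x \<partial>basis_measure (A \<union> B)) =
    (\<integral>\<^sup>+x. (\<integral>\<^sup>+y. h (x + y) \<partial>basis_measure B) \<partial>basis_measure A)"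
proof -
  interpret B: sigma_finite_measure "basis_measure B"
    using assms(2) by (rule sigma_finite_basis_measure)
  interpret BL: pair_sigma_finite "basis_measure B" lborel by standard
  have "finite A" using assms by simp
  then show ?thesis using assms(3) h
  proof (induction A arbitrary: h)
    case empty
    note [measurable] = \<open>h \<in> borel_measurable borel\<close>
    show ?case
      by (subst nn_integral_basis_measure_empty) simp_all
  next
    case (insert a A)
    note [measurable] = \<open>h \<in> borel_measurable borel\<close>
    have "(\<integral>\<^sup>+x. h x \<partial>basis_measure (insert a A \<union> B)) =
      (\<integral>\<^sup>+x. (\<integral>\<^sup>+t. h (t *\<^sub>R a + x) \<partial>lborel) \<partial>basis_measure (A \<union> B))"
      using insert assms(2) by (simp add: nn_integral_basis_measure_insert)
    also have "\<dots> = (\<integral>\<^sup>+x. (\<integral>\<^sup>+y. (\<integral>\<^sup>+t. h (t *\<^sub>R a + (x + y)) \<partial>lborel)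
        \<partial>basis_measure B) \<partial>basis_measure A)"
      using insert by (intro insert.IH) auto
    also have "\<dots> = (\<integral>\<^sup>+x. (\<integral>\<^sup>+t. (\<integral>\<^sup>+y. h (t *\<^sub>R a + (x + y)) \<partial>basis_measure B)
        \<partial>lborel) \<partial>basis_measure A)"
      by (intro nn_integral_cong BL.Fubini'[symmetric]) measurable
    also have "\<dots> = (\<integral>\<^sup>+x. (\<integral>\<^sup>+y. h (x + y) \<partial>basis_measure B) \<partial>basis_measure (insert a A))"
      using insert by (subst nn_integral_basis_measure_insert) (auto simp: add.assoc)
    finally show ?case .
  qed
qed

text \<open>Translations by vectors of the span and the reflection at the origin act on each coordinate
  separately, so invariance reduces to the line. The sign \<open>\<sigma>\<close> treats both at once.\<close>

lemma nn_integral_basis_measure_affine: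
  fixes h :: "'a::{real_inner,second_countable_topology} \<Rightarrow> ennreal"
  assumes "finite B" "v \<in> span B" "\<bar>\<sigma>\<bar> = 1" and h: "h \<in> borel_measurable borel"
  shows "(\<integral>\<^sup>+x. h (v + \<sigma> *\<^sub>R x) \<partial>basis_measure B) = (\<integral>\<^sup>+x. h x \<partial>basis_measure B)"
proof -
  obtain c where v: "v = (\<Sum>b\<in>B. c b *\<^sub>R b)"
    using assms by (auto simp: span_finite)
  show ?thesis unfolding v using assms(1) h
  proof (induction B arbitrary: h)
    case empty
    note [measurable] = \<open>h \<in> borel_measurable borel\<close>
    show ?case by (simp add: nn_integral_basis_measure_empty)
  next
    case (insert b B)
    note [measurable] = \<open>h \<in> borel_measurable borel\<close>
    define v where "v = (\<Sum>b\<in>B. c b *\<^sub>R b)"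
    define g where "g x = (\<integral>\<^sup>+t. h (t *\<^sub>R b + x) \<partial>lborel)" for x
    have [measurable]: "g \<in> borel_measurable borel" unfolding g_def by measurable
    have "(\<integral>\<^sup>+x. h ((\<Sum>b\<in>insert b B. c b *\<^sub>R b) + \<sigma> *\<^sub>R x) \<partial>basis_measure (insert b B)) =
      (\<integral>\<^sup>+x. (\<integral>\<^sup>+t. h (c b *\<^sub>R b + v + \<sigma> *\<^sub>R (t *\<^sub>R b + x)) \<partial>lborel) \<partial>basis_measure B)"
      using insert by (subst nn_integral_basis_measure_insert) (auto simp: v_def)
    also have "\<dots> = (\<integral>\<^sup>+x. (\<integral>\<^sup>+t. h ((c b + \<sigma> * t) *\<^sub>R b + (v + \<sigma> *\<^sub>R x)) \<partial>lborel) \<partial>basis_measure B)"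
      by (simp add: algebra_simps)
    also have "\<dots> = (\<integral>\<^sup>+x. g (v + \<sigma> *\<^sub>R x) \<partial>basis_measure B)"
      unfolding g_def
    proof (rule nn_integral_cong)
      fix x
      have "\<sigma> \<noteq> 0" using assms(3) by auto
      show "(\<integral>\<^sup>+t. h ((c b + \<sigma> * t) *\<^sub>R b + (v + \<sigma> *\<^sub>R x)) \<partial>lborel) =
            (\<integral>\<^sup>+t. h (t *\<^sub>R b + (v + \<sigma> *\<^sub>R x)) \<partial>lborel)"
        using nn_integral_real_affine[of "\<lambda>t. h (t *\<^sub>R b + (v + \<sigma> *\<^sub>R x))" \<sigma> "c b"] \<open>\<sigma> \<noteq> 0\<close> assms(3)
        by simp
    qed
    also have "\<dots> = (\<integral>\<^sup>+x. g x \<partial>basis_measure B)"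
      unfolding v_def by (intro insert.IH) auto
    also have "\<dots> = (\<integral>\<^sup>+x. h x \<partial>basis_measure (insert b B))"
      using insert by (simp add: nn_integral_basis_measure_insert g_def)
    finally show ?case .
  qed
qed

text \<open>The uniqueness argument for Haar measure: the integral of \<open>f x * g (y - x)\<close> over both variables
  is evaluated in two ways. The inner integral over \<open>y\<close> only sees a translation of \<open>g\<close>, while the
  substitution \<open>x \<mapsto> y - x\<close> in the other order swaps the roles of \<open>f\<close> and \<open>g\<close>.\<close>

lemma nn_integral_basis_measure_exchange:
  fixes f g :: "'a::{real_inner,second_countable_topology} \<Rightarrow> ennreal"
  assumes "orthonormal A" "orthonormal B" "span A = span B"
    and [measurable]: "f \<in> borel_measurable borel" "g \<in> borel_measurable borel"
  shows "(\<integral>\<^sup>+x. f x \<partial>basis_measure A) * (\<integral>\<^sup>+x. g x \<partial>basis_measure B) =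
         (\<integral>\<^sup>+x. g x \<partial>basis_measure A) * (\<integral>\<^sup>+x. f x \<partial>basis_measure B)"
proof -
  interpret A: sigma_finite_measure "basis_measure A"
    using assms(1) by (rule sigma_finite_basis_measure)
  interpret B: sigma_finite_measure "basis_measure B"
    using assms(2) by (rule sigma_finite_basis_measure)
  interpret AB: pair_sigma_finite "basis_measure A" "basis_measure B" by standard
  have *: "(\<integral>\<^sup>+x. p x \<partial>basis_measure A) * (\<integral>\<^sup>+x. q x \<partial>basis_measure B) =
      (\<integral>\<^sup>+y. (\<integral>\<^sup>+x. p x * q (y - x) \<partial>basis_measure A) \<partial>basis_measure B)"
    if [measurable]: "p \<in> borel_measurable borel" "q \<in> borel_measurable borel" for p q :: "'a \<Rightarrow> ennreal"
  proof -
    have "(\<integral>\<^sup>+x. p x \<partial>basis_measure A) * (\<integral>\<^sup>+x. q x \<partial>basis_measure B)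
        = (\<integral>\<^sup>+x. p x * (\<integral>\<^sup>+y. q y \<partial>basis_measure B) \<partial>basis_measure A)"
      by (simp add: nn_integral_multc)
    also have "\<dots> = (\<integral>\<^sup>+x. (\<integral>\<^sup>+y. p x * q (y - x) \<partial>basis_measure B) \<partial>basis_measure A)"
      using AE_basis_measure_span[OF assms(1)]
    proof (intro nn_integral_cong_AE, eventually_elim)
      case (elim x)
      then have "(\<integral>\<^sup>+y. q (y - x) \<partial>basis_measure B) = (\<integral>\<^sup>+y. q y \<partial>basis_measure B)"
        using nn_integral_basis_measure_affine[of B "-x" 1 q] assms by (simp add: span_neg)
      then show ?case by (simp add: nn_integral_cmult)
    qed
    also have "\<dots> = (\<integral>\<^sup>+y. (\<integral>\<^sup>+x. p x * q (y - x) \<partial>basis_measure A) \<partial>basis_measure B)"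
      by (intro AB.Fubini'[symmetric]) measurable
    finally show ?thesis .
  qed
  have "(\<integral>\<^sup>+y. (\<integral>\<^sup>+x. f x * g (y - x) \<partial>basis_measure A) \<partial>basis_measure B) =
        (\<integral>\<^sup>+y. (\<integral>\<^sup>+x. g x * f (y - x) \<partial>basis_measure A) \<partial>basis_measure B)"
    using AE_basis_measure_span[OF assms(2)]
  proof (intro nn_integral_cong_AE, eventually_elim)
    case (elim y)
    then show ?case
      using nn_integral_basis_measure_affine[of A y "-1" "\<lambda>x. f x * g (y - x)"] assms
      by (simp add: mult.commute)
  qed
  then show ?thesis by (simp add: *)
qed

text \<open>A rotation invariant test function with a finite positive integral that depends on the number of
  basis vectors only; it fixes the normalisation in the uniqueness of Lebesgue measure.\<close>

lemma nn_integral_basis_measure_gaussian: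
  fixes B :: "'a::{real_inner,second_countable_topology} set"
  assumes "orthonormal B"
  shows "(\<integral>\<^sup>+x. ennreal (exp (- (norm x)\<^sup>2)) \<partial>basis_measure B) = ennreal (sqrt pi) ^ card B"
proof -
  have "has_bochner_integral lborel (\<lambda>x::real. exp (- x\<^sup>2)) (sqrt pi)"
    using has_bochner_integral_even_function[OF gaussian_moment_0] by simp
  then have 1: "(\<integral>\<^sup>+t. ennreal (exp (- t\<^sup>2)) \<partial>lborel) = ennreal (sqrt pi)"
    by (subst nn_integral_eq_integral) (auto simp: has_bochner_integral_iff)
  have "(\<integral>\<^sup>+x. ennreal (exp (- (norm x)\<^sup>2)) \<partial>basis_measure B) =
    (\<integral>\<^sup>+x. (\<Prod>b\<in>B. ennreal (exp (- (x b)\<^sup>2))) \<partial>(\<Pi>\<^sub>M b\<in>B. lborel))"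
    using assms
    by (subst nn_integral_basis_measure)
       (auto simp: norm_sum_orthonormal exp_sum prod_ennreal simp flip: sum_negf)
  also have "\<dots> = (\<Prod>b\<in>B. \<integral>\<^sup>+t. ennreal (exp (- t\<^sup>2)) \<partial>lborel)"
    using assms by (intro lborel_family.product_nn_integral_prod) auto
  finally show ?thesis by (simp add: 1)
qed

lemma basis_measure_unique:
  fixes A B :: "'a::{real_inner,second_countable_topology} set"
  assumes "orthonormal A" "orthonormal B" "span A = span B"
  shows "basis_measure A = basis_measure B"
proof (rule measure_eqI)
  fix X assume "X \<in> sets (basis_measure A)"
  then have [measurable]: "X \<in> sets borel" by simp
  have card: "card A = card B" using assms orthonormal_card by metis
  let ?c = "ennreal (sqrt pi) ^ card B"
  have "emeasure (basis_measure A) X * ?c = ?c * emeasure (basis_measure B) X"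
    using nn_integral_basis_measure_exchange[OF assms, of "indicator X" "\<lambda>x. ennreal (exp (- (norm x)\<^sup>2))"]
    by (simp add: nn_integral_basis_measure_gaussian assms card)
  moreover have "?c \<noteq> 0" "?c \<noteq> \<infinity>" by (auto simp: ennreal_power)
  ultimately show "emeasure (basis_measure A) X = emeasure (basis_measure B) X"
    by (simp add: mult.commute[of _ ?c] ennreal_mult_cancel_left)
qed simp

lemma lborel_of_eq_basis_measure:
  fixes B :: "'a::{real_inner,second_countable_topology} set"
  assumes "orthonormal B" "span B = V"
  shows "lborel_of V = basis_measure B"
proof -
  define B' where "B' = (SOME B. orthonormal_basis B V)"
  have "orthonormal_basis B V" using assms by (simp add: orthonormal_basis_def orthonormal_def)
  then have B': "orthonormal_basis B' V" unfolding B'_def by (rule someI)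
  have "independent B'"
    using B' by (intro pairwise_orthogonal_independent) (auto simp: orthonormal_basis_def)
  moreover have "B' \<subseteq> span B" using B' assms span_base by (auto simp: orthonormal_basis_def)
  ultimately have "finite B'" using assms(1) independent_span_bound[of B B'] by auto
  then have "orthonormal B'" using B' by (simp add: orthonormal_basis_def orthonormal_def)
  then have "basis_measure B' = basis_measure B"
    using assms B' by (intro basis_measure_unique) (auto simp: orthonormal_basis_def)
  then show ?thesis by (simp add: lborel_of_def Let_def B'_def[symmetric] basis_measure_def)
qed

section \<open>The Prekopa-Leindler inequality for midpoints\<close>

text \<open>The midpoints of \<open>A \<inter> {..a}\<close> with \<open>b\<close> lie to the left of \<open>(a + b) / 2\<close>, those of \<open>a\<close> with
  \<open>B \<inter> {b..}\<close> to the right. So \<open>M\<close> contains copies of both sets, shrunk by one half, which overlap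
  in one point at most.\<close>

lemma emeasure_midpoint_line_split:
  fixes A B M :: "real set"
  assumes [measurable]: "A \<in> sets borel" "B \<in> sets borel" "M \<in> sets borel"
    and mid: "\<And>a b. a \<in> A \<Longrightarrow> b \<in> B \<Longrightarrow> (a + b) / 2 \<in> M"
    and a: "a \<in> A" and b: "b \<in> B"
  shows "emeasure lborel (A \<inter> {..a}) + emeasure lborel (B \<inter> {b..}) \<le> 2 * emeasure lborel M"
proof -
  have half: "emeasure lborel X = 2 * (\<integral>\<^sup>+y. indicator X (- c + 2 * y) \<partial>lborel)"
    if [measurable]: "X \<in> sets borel" for X :: "real set" and c
    using nn_integral_real_affine[of "indicator X" 2 "- c"] by simp
  let ?m = "(a + b) / 2"
  have "emeasure lborel (A \<inter> {..a}) + emeasure lborel (B \<inter> {b..}) =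
    2 * (\<integral>\<^sup>+y. indicator (A \<inter> {..a}) (- b + 2 * y) + indicator (B \<inter> {b..}) (- a + 2 * y) \<partial>lborel)"
    by (subst nn_integral_add)
       (auto simp: half[of "A \<inter> {..a}" b] half[of "B \<inter> {b..}" a] distrib_left)
  also have "\<dots> \<le> 2 * (\<integral>\<^sup>+y. indicator M y + indicator {?m} y \<partial>lborel)"
  proof (intro mult_left_mono nn_integral_mono)
    fix y :: real
    have 1: "y \<in> M" "y \<le> ?m" if "- b + 2 * y \<in> A \<inter> {..a}"
      using mid[of "- b + 2 * y" b] that b by auto
    have 2: "y \<in> M" "?m \<le> y" if "- a + 2 * y \<in> B \<inter> {b..}"
      using mid[of a "- a + 2 * y"] that a by auto
    show "(indicator (A \<inter> {..a}) (- b + 2 * y) + indicator (B \<inter> {b..}) (- a + 2 * y) :: ennreal)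
      \<le> indicator M y + indicator {?m} y"
      using 1 2 by (auto split: split_indicator)
  qed simp
  also have "\<dots> = 2 * emeasure lborel M"
    by (subst nn_integral_add) auto
  finally show ?thesis .
qed

text \<open>For \<open>a\<close> near the supremum of \<open>A\<close> and \<open>b\<close> near the infimum of \<open>B\<close> the truncations in the previous
  lemma lose arbitrarily little, which replaces the usual passage to compact subsets.\<close>

lemma emeasure_midpoint_line_bounded:
  fixes A B M :: "real set"
  assumes [measurable]: "A \<in> sets borel" "B \<in> sets borel" "M \<in> sets borel"
    and mid: "\<And>a b. a \<in> A \<Longrightarrow> b \<in> B \<Longrightarrow> (a + b) / 2 \<in> M"
    and ne: "A \<noteq> {}" "B \<noteq> {}" and bdd: "bdd_above A" "bdd_below B"
  shows "emeasure lborel A + emeasure lborel B \<le> 2 * emeasure lborel M"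
proof (rule ennreal_le_epsilon)
  fix e :: real assume "e > 0"
  obtain a where a: "a \<in> A" "Sup A - e / 2 < a"
    using less_cSup_iff[OF ne(1) bdd(1), of "Sup A - e / 2"] \<open>e > 0\<close> by auto
  obtain b where b: "b \<in> B" "b < Inf B + e / 2"
    using cInf_less_iff[OF ne(2) bdd(2), of "Inf B + e / 2"] \<open>e > 0\<close> by auto
  have "A \<subseteq> (A \<inter> {..a}) \<union> {Sup A - e / 2..Sup A}"
    using a cSup_upper[OF _ bdd(1)] by force
  then have "emeasure lborel A \<le> emeasure lborel ((A \<inter> {..a}) \<union> {Sup A - e / 2..Sup A})"
    by (intro emeasure_mono) auto
  also have "\<dots> \<le> emeasure lborel (A \<inter> {..a}) + emeasure lborel {Sup A - e / 2..Sup A}"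
    by (intro emeasure_subadditive) auto
  finally have A: "emeasure lborel A \<le> emeasure lborel (A \<inter> {..a}) + ennreal (e / 2)"
    using \<open>e > 0\<close> by simp
  have "B \<subseteq> (B \<inter> {b..}) \<union> {Inf B..Inf B + e / 2}"
    using b cInf_lower[OF _ bdd(2)] by force
  then have "emeasure lborel B \<le> emeasure lborel ((B \<inter> {b..}) \<union> {Inf B..Inf B + e / 2})"
    by (intro emeasure_mono) auto
  also have "\<dots> \<le> emeasure lborel (B \<inter> {b..}) + emeasure lborel {Inf B..Inf B + e / 2}"
    by (intro emeasure_subadditive) auto
  finally have B: "emeasure lborel B \<le> emeasure lborel (B \<inter> {b..}) + ennreal (e / 2)"
    using \<open>e > 0\<close> by simp
  have "emeasure lborel A + emeasure lborel B \<le>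
    (emeasure lborel (A \<inter> {..a}) + emeasure lborel (B \<inter> {b..})) + (ennreal (e / 2) + ennreal (e / 2))"
    using add_mono[OF A B] by (simp add: ac_simps)
  also have "ennreal (e / 2) + ennreal (e / 2) = ennreal e"
    using \<open>e > 0\<close> by (subst ennreal_plus[symmetric]) auto
  finally show "emeasure lborel A + emeasure lborel B \<le> 2 * emeasure lborel M + ennreal e"
    using emeasure_midpoint_line_split[OF assms(1-4) a(1) b(1)]
    by (meson add_right_mono order_trans)
qed

lemma emeasure_midpoint_line:
  fixes A B M :: "real set"
  assumes [measurable]: "A \<in> sets borel" "B \<in> sets borel" "M \<in> sets borel"
    and mid: "\<And>a b. a \<in> A \<Longrightarrow> b \<in> B \<Longrightarrow> (a + b) / 2 \<in> M"
    and ne: "A \<noteq> {}" "B \<noteq> {}"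
  shows "emeasure lborel A + emeasure lborel B \<le> 2 * emeasure lborel M"
proof -
  define T where "T X n = X \<inter> {- real n..real n}" for X and n :: nat
  have cover: "(\<Union>n. T X n) = X" for X
  proof (intro equalityI subsetI)
    fix x assume "x \<in> X"
    moreover obtain n :: nat where "\<bar>x\<bar> \<le> n" using real_arch_simple by blast
    ultimately have "x \<in> T X n" by (simp add: T_def abs_le_iff)
    then show "x \<in> (\<Union>n. T X n)" by blast
  qed (auto simp: T_def)
  have inc: "incseq (T X)" for X
    unfolding T_def by (intro monoI Int_mono order_refl) (simp add: atLeastatMost_subset_iff)
  have lim: "(\<lambda>n. emeasure lborel (T X n)) \<longlonglongrightarrow> emeasure lborel X"
    if [measurable]: "X \<in> sets borel" for X
  proof -
    have "range (T X) \<subseteq> sets lborel" unfolding T_def by auto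
    then show ?thesis using Lim_emeasure_incseq[OF _ inc, of X lborel] cover by metis
  qed
  have ev: "eventually (\<lambda>n. T X n \<noteq> {}) sequentially" if "X \<noteq> {}" for X
  proof -
    obtain x where "x \<in> X" using \<open>X \<noteq> {}\<close> by blast
    then have "x \<in> (\<Union>n. T X n)" by (simp only: cover)
    then obtain m where "T X m \<noteq> {}" by blast
    then show ?thesis
      using inc[of X] unfolding eventually_sequentially by (metis incseqD subset_empty)
  qed
  show ?thesis
  proof (rule tendsto_le[OF sequentially_bot tendsto_const tendsto_add[OF lim lim]])
    show "\<forall>\<^sub>F n in sequentially. emeasure lborel (T A n) + emeasure lborel (T B n) \<le> 2 * emeasure lborel M"
      using ev[OF ne(1)] ev[OF ne(2)]
    proof eventually_elim
      case (elim n)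
      show ?case
      proof (rule emeasure_midpoint_line_bounded)
        show "bdd_above (T A n)" "bdd_below (T B n)" by (auto simp: T_def)
      qed (use elim mid in \<open>auto simp: T_def\<close>)
    qed
  qed auto
qed

text \<open>Levels above \<open>1\<close> are cut off, because the set inequality on the line needs both superlevel sets to
  be non-empty.\<close>

lemma nn_integral_layer_cake_unit:
  fixes F :: "real \<Rightarrow> ennreal"
  assumes [measurable]: "F \<in> borel_measurable borel"
  shows "(\<integral>\<^sup>+s. emeasure lborel {x. ennreal s < F x} * indicator {0<..<1} s \<partial>lborel) =
    (\<integral>\<^sup>+x. min (F x) 1 \<partial>lborel)"
proof -
  have "(\<integral>\<^sup>+s. emeasure lborel {x. ennreal s < F x} * indicator {0<..<1} s \<partial>lborel) =
    (\<integral>\<^sup>+s. (\<integral>\<^sup>+x. indicator {x. ennreal s < F x} x * indicator {0<..<1} s \<partial>lborel) \<partial>lborel)"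
    by (simp add: nn_integral_multc)
  also have "\<dots> = (\<integral>\<^sup>+x. (\<integral>\<^sup>+s. indicator {x. ennreal s < F x} x * indicator {0<..<1} s \<partial>lborel) \<partial>lborel)"
    by (intro lborel_pair.Fubini') measurable
  also have "\<dots> = (\<integral>\<^sup>+x. min (F x) 1 \<partial>lborel)"
  proof (rule nn_integral_cong)
    fix x
    have "(\<integral>\<^sup>+s. indicator {x. ennreal s < F x} x * indicator {0<..<1} s \<partial>lborel) =
      (\<integral>\<^sup>+s. indicator {0<..<enn2real (min (F x) 1)} s \<partial>lborel)"
    proof (rule nn_integral_cong)
      fix s :: real
      have "ennreal s < F x \<longleftrightarrow> s < enn2real (min (F x) 1)" if "0 < s" "s < 1"
        using that by (cases "F x") (auto simp: min_def ennreal_less_iff top_unique)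
      moreover have "enn2real (min (F x) 1) \<le> 1"
        by (cases "F x") (auto simp: min_def top_unique)
      ultimately show "indicator {x. ennreal s < F x} x * indicator {0<..<1} s =
        (indicator {0<..<enn2real (min (F x) 1)} s :: ennreal)"
        by (auto split: split_indicator)
    qed
    also have "\<dots> = ennreal (enn2real (min (F x) 1))" by simp
    also have "\<dots> = min (F x) 1" by (cases "F x") (auto simp: min_def top_unique)
    finally show "(\<integral>\<^sup>+s. indicator {x. ennreal s < F x} x * indicator {0<..<1} s \<partial>lborel) = min (F x) 1" .
  qed
  finally show ?thesis .
qed

text \<open>With both suprema equal to \<open>1\<close> the superlevel sets of \<open>F\<close> and \<open>G\<close> at every level \<open>s < 1\<close> are
  non-empty, and their midpoints lie in the superlevel set of \<open>H\<close> at the same level. Integration over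
  \<open>s\<close> gives the arithmetic form of the inequality.\<close>

lemma prekopa_leindler_line_normalized:
  fixes F G H :: "real \<Rightarrow> ennreal"
  assumes [measurable]: "F \<in> borel_measurable borel" "G \<in> borel_measurable borel" "H \<in> borel_measurable borel"
    and mid: "\<And>x y. F x * G y \<le> (H ((x + y) / 2))\<^sup>2"
    and le: "\<And>x. F x \<le> 1" "\<And>x. G x \<le> 1"
    and sup: "\<And>s. 0 < s \<Longrightarrow> s < 1 \<Longrightarrow> \<exists>x. ennreal s < F x"
      "\<And>s. 0 < s \<Longrightarrow> s < 1 \<Longrightarrow> \<exists>x. ennreal s < G x"
  shows "(\<integral>\<^sup>+x. F x \<partial>lborel) + (\<integral>\<^sup>+x. G x \<partial>lborel) \<le> 2 * (\<integral>\<^sup>+x. H x \<partial>lborel)"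
proof -
  let ?I = "\<lambda>F. \<integral>\<^sup>+s. emeasure lborel {x. ennreal s < F x} * indicator {0<..<1} s \<partial>lborel"
  have meas: "(\<lambda>s. emeasure lborel {x. ennreal s < F x} * indicator {0<..<1} s) \<in> borel_measurable lborel"
    if [measurable]: "F \<in> borel_measurable borel" for F :: "real \<Rightarrow> ennreal"
  proof -
    have "(\<lambda>s. (\<integral>\<^sup>+x. indicator {x. ennreal s < F x} x \<partial>lborel) * indicator {0<..<1} s)
      \<in> borel_measurable lborel" by measurable
    then show ?thesis by simp
  qed
  have "(\<integral>\<^sup>+x. F x \<partial>lborel) + (\<integral>\<^sup>+x. G x \<partial>lborel) = ?I F + ?I G"
    by (simp add: nn_integral_layer_cake_unit min_absorb1 le)
  also have "\<dots> = (\<integral>\<^sup>+s. (emeasure lborel {x. ennreal s < F x} + emeasure lborel {x. ennreal s < G x})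
      * indicator {0<..<1} s \<partial>lborel)"
    by (subst nn_integral_add[symmetric]) (auto intro!: meas simp: distrib_right)
  also have "\<dots> \<le> (\<integral>\<^sup>+s. 2 * (emeasure lborel {x. ennreal s < H x} * indicator {0<..<1} s) \<partial>lborel)"
  proof (rule nn_integral_mono)
    fix s :: real
    show "(emeasure lborel {x. ennreal s < F x} + emeasure lborel {x. ennreal s < G x}) * indicator {0<..<1} s
      \<le> 2 * (emeasure lborel {x. ennreal s < H x} * indicator {0<..<1} s)"
    proof (cases "s \<in> {0<..<1}")
      case True
      have "emeasure lborel {x. ennreal s < F x} + emeasure lborel {x. ennreal s < G x}
        \<le> 2 * emeasure lborel {x. ennreal s < H x}"
      proof (rule emeasure_midpoint_line)
        fix a b assume "a \<in> {x. ennreal s < F x}" "b \<in> {x. ennreal s < G x}"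
        then have "ennreal s * ennreal s < F a * G b"
          using True by (cases "F a"; cases "G b")
            (auto simp: ennreal_mult_less_top ennreal_less_iff ennreal_mult_top ennreal_top_mult
              simp flip: ennreal_mult intro!: mult_strict_mono)
        also have "\<dots> \<le> (H ((a + b) / 2))\<^sup>2" by (rule mid)
        finally have "(ennreal s)\<^sup>2 < (H ((a + b) / 2))\<^sup>2" by (simp add: power2_eq_square)
        then show "(a + b) / 2 \<in> {x. ennreal s < H x}"
          by (metis linorder_not_le mem_Collect_eq power_mono zero_le)
      qed (use sup True in auto)
      then show ?thesis using True by simp
    qed simp
  qed
  also have "\<dots> = 2 * ?I H" by (rule nn_integral_cmult) (rule meas, simp)
  also have "\<dots> \<le> 2 * (\<integral>\<^sup>+x. H x \<partial>lborel)"
    by (auto simp: nn_integral_layer_cake_unit intro!: mult_left_mono nn_integral_mono)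
  finally show ?thesis .
qed

text \<open>Dividing \<open>F\<close> and \<open>G\<close> by their suprema \<open>a\<close> and \<open>b\<close> and \<open>H\<close> by \<open>sqrt (a * b)\<close> reduces to the
  normalised case; the arithmetic-geometric mean inequality makes the factors cancel.\<close>

lemma prekopa_leindler_line_bounded:
  fixes F G H :: "real \<Rightarrow> ennreal"
  assumes [measurable]: "F \<in> borel_measurable borel" "G \<in> borel_measurable borel" "H \<in> borel_measurable borel"
    and mid: "\<And>x y. F x * G y \<le> (H ((x + y) / 2))\<^sup>2"
    and fin: "(SUP x. F x) < \<infinity>" "(SUP x. G x) < \<infinity>"
  shows "(\<integral>\<^sup>+x. F x \<partial>lborel) * (\<integral>\<^sup>+x. G x \<partial>lborel) \<le> (\<integral>\<^sup>+x. H x \<partial>lborel)\<^sup>2"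
proof (cases "(SUP x. F x) = 0 \<or> (SUP x. G x) = 0")
  case True
  then have "(\<forall>x. F x = 0) \<or> (\<forall>x. G x = 0)"
    by (metis SUP_upper UNIV_I le_zero_eq)
  then show ?thesis by auto
next
  case False
  obtain a where a: "(SUP x. F x) = ennreal a" "a > 0"
    using fin False by (cases "SUP x. F x") (auto simp: less_le)
  obtain b where b: "(SUP x. G x) = ennreal b" "b > 0"
    using fin False by (cases "SUP x. G x") (auto simp: less_le)
  have scale: "F x * ennreal (1 / a) \<le> 1" "0 < s \<Longrightarrow> s < 1 \<Longrightarrow> \<exists>x. ennreal s < F x * ennreal (1 / a)"
    if a: "(SUP x. F x) = ennreal a" "a > 0" for F :: "real \<Rightarrow> ennreal" and a x s
  proof -
    have le: "F x \<le> ennreal a" for x using a by (metis SUP_upper UNIV_I)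
    then have r: "\<exists>r\<ge>0. r \<le> a \<and> F x = ennreal r" for x
      using le[of x] a by (cases "F x") (auto simp: top_unique)
    show "F x * ennreal (1 / a) \<le> 1"
      using r[of x] a by (auto simp flip: ennreal_mult)
    assume s: "0 < s" "s < 1"
    then have "ennreal (s * a) < (SUP x. F x)" using a by (simp add: ennreal_less_iff)
    then obtain y where y: "ennreal (s * a) < F y" by (auto simp: less_SUP_iff)
    obtain r where "r \<ge> 0" "F y = ennreal r" using r by blast
    then have "ennreal s < F y * ennreal (1 / a)"
      using y a s by (auto simp: ennreal_less_iff field_simps simp flip: ennreal_mult)
    then show "\<exists>x. ennreal s < F x * ennreal (1 / a)" by blast
  qed
  let ?c = "1 / sqrt (a * b)"
  have c: "(ennreal ?c)\<^sup>2 = ennreal (1 / a) * ennreal (1 / b)"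
    using a b by (simp add: ennreal_power power_divide flip: ennreal_mult)
  have "(\<integral>\<^sup>+x. F x * ennreal (1 / a) \<partial>lborel) + (\<integral>\<^sup>+x. G x * ennreal (1 / b) \<partial>lborel)
    \<le> 2 * (\<integral>\<^sup>+x. H x * ennreal ?c \<partial>lborel)"
  proof (rule prekopa_leindler_line_normalized)
    fix x y
    have "F x * ennreal (1 / a) * (G y * ennreal (1 / b)) = (F x * G y) * (ennreal ?c)\<^sup>2"
      by (simp add: c ac_simps)
    also have "\<dots> \<le> (H ((x + y) / 2))\<^sup>2 * (ennreal ?c)\<^sup>2"
      by (intro mult_right_mono mid) simp
    finally show "F x * ennreal (1 / a) * (G y * ennreal (1 / b)) \<le> (H ((x + y) / 2) * ennreal ?c)\<^sup>2"
      by (simp add: power_mult_distrib)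
  qed (use scale[OF a] scale[OF b] in auto)
  then have *: "(\<integral>\<^sup>+x. F x \<partial>lborel) * ennreal (1 / a) + (\<integral>\<^sup>+x. G x \<partial>lborel) * ennreal (1 / b)
    \<le> 2 * ((\<integral>\<^sup>+x. H x \<partial>lborel) * ennreal ?c)"
    by (simp add: nn_integral_multc)
  show ?thesis
  proof (cases "\<integral>\<^sup>+x. H x \<partial>lborel")
    case (real h)
    then have fin: "2 * ((\<integral>\<^sup>+x. H x \<partial>lborel) * ennreal ?c) < \<infinity>"
      by (simp add: ennreal_mult_less_top)
    have "(\<integral>\<^sup>+x. F x \<partial>lborel) * ennreal (1 / a) < \<infinity>" "(\<integral>\<^sup>+x. G x \<partial>lborel) * ennreal (1 / b) < \<infinity>"
      using le_less_trans[OF * fin] by auto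
    then have "(\<integral>\<^sup>+x. F x \<partial>lborel) < \<infinity>" "(\<integral>\<^sup>+x. G x \<partial>lborel) < \<infinity>"
      using a b by (auto simp: ennreal_mult_less_top)
    then obtain p q where p: "(\<integral>\<^sup>+x. F x \<partial>lborel) = ennreal p" "p \<ge> 0"
      and q: "(\<integral>\<^sup>+x. G x \<partial>lborel) = ennreal q" "q \<ge> 0"
      by (metis ennreal_cases infinity_ennreal_def less_irrefl)
    have "ennreal (p / a + q / b) \<le> ennreal (2 * (h * ?c))"
      using * p q real a b by (simp add: ennreal_mult[symmetric] ennreal_plus[symmetric] del: ennreal_plus flip: ennreal_numeral)
    then have le: "p / a + q / b \<le> 2 * (h * ?c)"
      using real a b by (subst (asm) ennreal_le_iff) auto
    have "4 * ((p / a) * (q / b)) \<le> (p / a + q / b)\<^sup>2"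
    proof -
      have "4 * (u * v) \<le> (u + v)\<^sup>2" for u v :: real
        using zero_le_power2[of "u - v"] by (simp add: power2_eq_square algebra_simps)
      then show ?thesis .
    qed
    also have "\<dots> \<le> (2 * (h * ?c))\<^sup>2"
      using le p q a b by (intro power_mono) auto
    also have "\<dots> = 4 * (h\<^sup>2 / (a * b))"
      using a b by (simp add: power_mult_distrib power_divide)
    finally have "p * q \<le> h\<^sup>2" using a b by (simp add: field_simps)
    then show ?thesis using p q real by (simp add: ennreal_power flip: ennreal_mult)
  qed simp
qed

lemma SUP_min_of_nat: "(SUP n::nat. min x (of_nat n)) = (x :: ennreal)"
proof (rule antisym)
  show "x \<le> (SUP n::nat. min x (of_nat n))"
  proof (cases x)
    case (real r)
    obtain n :: nat where "r \<le> n" using real_arch_simple by blast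
    then have "x \<le> min x (of_nat n)" using real by (simp add: ennreal_of_nat_eq_real_of_nat ennreal_leI)
    also have "\<dots> \<le> (SUP n::nat. min x (of_nat n))" by (rule SUP_upper) simp
    finally show ?thesis .
  next
    case top
    then show ?thesis by (simp add: ennreal_SUP_of_nat_eq_top min_def top_unique)
  qed
qed (auto intro: SUP_least)

lemma prekopa_leindler_line:
  fixes F G H :: "real \<Rightarrow> ennreal"
  assumes [measurable]: "F \<in> borel_measurable borel" "G \<in> borel_measurable borel" "H \<in> borel_measurable borel"
    and mid: "\<And>x y. F x * G y \<le> (H ((x + y) / 2))\<^sup>2"
  shows "(\<integral>\<^sup>+x. F x \<partial>lborel) * (\<integral>\<^sup>+x. G x \<partial>lborel) \<le> (\<integral>\<^sup>+x. H x \<partial>lborel)\<^sup>2"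
proof -
  have trunc: "(\<integral>\<^sup>+x. f x \<partial>lborel) = (SUP n::nat. \<integral>\<^sup>+x. min (f x) (of_nat n) \<partial>lborel)"
    if [measurable]: "f \<in> borel_measurable borel" for f :: "real \<Rightarrow> ennreal"
  proof -
    have "(\<integral>\<^sup>+x. f x \<partial>lborel) = (\<integral>\<^sup>+x. (SUP n::nat. min (f x) (of_nat n)) \<partial>lborel)"
      by (simp add: SUP_min_of_nat)
    also have "\<dots> = (SUP n::nat. \<integral>\<^sup>+x. min (f x) (of_nat n) \<partial>lborel)"
      by (intro nn_integral_monotone_convergence_SUP)
         (auto simp: mono_def le_fun_def intro: min.coboundedI2 of_nat_mono)
    finally show ?thesis .
  qed
  have "(\<integral>\<^sup>+x. min (F x) (of_nat n) \<partial>lborel) * (\<integral>\<^sup>+x. min (G x) (of_nat m) \<partial>lborel)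
      \<le> (\<integral>\<^sup>+x. H x \<partial>lborel)\<^sup>2" for n m :: nat
  proof (rule prekopa_leindler_line_bounded)
    show "min (F x) (of_nat n) * min (G y) (of_nat m) \<le> (H ((x + y) / 2))\<^sup>2" for x y
      by (rule order_trans[OF mult_mono mid]) auto
    have "(SUP x. min (f x) (of_nat k)) \<le> (of_nat k :: ennreal)" for f :: "real \<Rightarrow> ennreal" and k
      by (rule SUP_least) simp
    moreover have "(of_nat k :: ennreal) < \<infinity>" for k by (simp add: of_nat_less_top)
    ultimately show "(SUP x. min (F x) (of_nat n)) < \<infinity>" "(SUP x. min (G x) (of_nat m)) < \<infinity>"
      by (meson le_less_trans)+
  qed auto
  then have "(SUP n::nat. SUP m::nat. (\<integral>\<^sup>+x. min (F x) (of_nat n) \<partial>lborel) *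
      (\<integral>\<^sup>+x. min (G x) (of_nat m) \<partial>lborel)) \<le> (\<integral>\<^sup>+x. H x \<partial>lborel)\<^sup>2"
    by (intro SUP_least)
  then show ?thesis
    unfolding SUP_mult_left_ennreal[symmetric] SUP_mult_right_ennreal[symmetric]
    by (simp only: trunc[symmetric] assms(1,2))
qed

text \<open>Integration over one basis vector preserves the hypothesis, by the inequality on the line, so the
  inequality passes to all dimensions by induction.\<close>

theorem prekopa_leindler:
  fixes F G H :: "'a::{real_inner,second_countable_topology} \<Rightarrow> ennreal"
  assumes "finite B"
    and "F \<in> borel_measurable borel" "G \<in> borel_measurable borel" "H \<in> borel_measurable borel"
    and "\<And>x y. F x * G y \<le> (H ((1/2) *\<^sub>R (x + y)))\<^sup>2"
  shows "(\<integral>\<^sup>+x. F x \<partial>basis_measure B) * (\<integral>\<^sup>+x. G x \<partial>basis_measure B)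
    \<le> (\<integral>\<^sup>+x. H x \<partial>basis_measure B)\<^sup>2"
  using assms
proof (induction B arbitrary: F G H)
  case empty
  show ?case using empty(4)[of 0 0] empty(1-3) by (simp add: nn_integral_basis_measure_empty)
next
  case (insert b B)
  note [measurable] = insert.prems(1-3)
  have step: "(\<integral>\<^sup>+t. F (t *\<^sub>R b + x) \<partial>lborel) * (\<integral>\<^sup>+t. G (t *\<^sub>R b + y) \<partial>lborel)
      \<le> (\<integral>\<^sup>+t. H (t *\<^sub>R b + (1/2) *\<^sub>R (x + y)) \<partial>lborel)\<^sup>2" for x y
  proof (rule prekopa_leindler_line)
    fix s t :: real
    have "(1/2) *\<^sub>R ((s *\<^sub>R b + x) + (t *\<^sub>R b + y)) = ((s + t) / 2) *\<^sub>R b + (1/2) *\<^sub>R (x + y)"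
      by (simp add: scaleR_add_right scaleR_add_left add_divide_distrib)
    then show "F (s *\<^sub>R b + x) * G (t *\<^sub>R b + y) \<le> (H (((s + t) / 2) *\<^sub>R b + (1/2) *\<^sub>R (x + y)))\<^sup>2"
      using insert.prems(4)[of "s *\<^sub>R b + x" "t *\<^sub>R b + y"] by simp
  qed measurable
  show ?case
    unfolding nn_integral_basis_measure_insert[OF insert.hyps insert.prems(1)]
      nn_integral_basis_measure_insert[OF insert.hyps insert.prems(2)]
      nn_integral_basis_measure_insert[OF insert.hyps insert.prems(3)]
    by (rule insert.IH) (measurable, rule step)
qed

lemma brunn_minkowski_midpoint:
  fixes B :: "'a::{real_inner,second_countable_topology} set"
  assumes "finite B" and [measurable]: "X \<in> sets borel" "Y \<in> sets borel" "Z \<in> sets borel"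
    and mid: "\<And>x y. x \<in> X \<Longrightarrow> y \<in> Y \<Longrightarrow> (1/2) *\<^sub>R (x + y) \<in> Z"
  shows "emeasure (basis_measure B) X * emeasure (basis_measure B) Y \<le> (emeasure (basis_measure B) Z)\<^sup>2"
proof -
  have "(indicator X x :: ennreal) * indicator Y y \<le> (indicator Z ((1/2) *\<^sub>R (x + y)))\<^sup>2" for x y
    using mid[of x y] by (auto split: split_indicator)
  then show ?thesis
    using prekopa_leindler[OF assms(1), of "indicator X" "indicator Y" "indicator Z"] by simp
qed

lemma emeasure_basis_measure_bounded:
  fixes B :: "'a::{real_inner,second_countable_topology} set"
  assumes "orthonormal B" "bounded X"
  shows "emeasure (basis_measure B) X < \<infinity>"
proof -
  obtain r where r: "\<And>x. x \<in> X \<Longrightarrow> norm x \<le> r" "r \<ge> 0"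
    using assms(2) bounded_pos[of X] by (meson less_imp_le)
  have "X \<subseteq> {x. \<forall>b\<in>B. \<bar>x \<bullet> b\<bar> \<le> r}"
  proof clarify
    fix x b assume "x \<in> X" "b \<in> B"
    then show "\<bar>x \<bullet> b\<bar> \<le> r"
      using Cauchy_Schwarz_ineq2[of x b] r(1)[of x] assms(1) by (simp add: orthonormal_def)
  qed
  moreover have "{x. \<forall>b\<in>B. \<bar>x \<bullet> b\<bar> \<le> r} \<in> sets borel"
    using orthonormal_finite[OF assms(1)] by measurable
  ultimately have "emeasure (basis_measure B) X \<le> emeasure (basis_measure B) {x. \<forall>b\<in>B. \<bar>x \<bullet> b\<bar> \<le> r}"
    by (intro emeasure_mono) auto
  also have "\<dots> < \<infinity>"
    using emeasure_basis_measure_box[OF assms(1), of "\<lambda>_. r"] r(2) by simp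
  finally show ?thesis .
qed

text \<open>The volume of the fibres of a compact set is upper semicontinuous: indicators of closed sets are,
  and the reverse Fatou lemma applies since nearby fibres lie in one ball.\<close>

lemma closed_superlevel_fibre_volume:
  fixes E K :: "'a::{real_inner,second_countable_topology} set"
  assumes E: "orthonormal E" and K: "compact K"
  shows "closed {x. c \<le> emeasure (basis_measure E) {y. x + y \<in> K}}"
  unfolding closed_sequential_limits
proof (intro allI impI, elim conjE)
  fix X :: "nat \<Rightarrow> 'a" and x
  assume X: "\<forall>n. X n \<in> {x. c \<le> emeasure (basis_measure E) {y. x + y \<in> K}}" and lim: "X \<longlonglongrightarrow> x"
  have [measurable]: "K \<in> sets borel" using K by (simp add: compact_imp_closed)
  have fib: "emeasure (basis_measure E) {y. z + y \<in> K} = (\<integral>\<^sup>+y. indicator K (z + y) \<partial>basis_measure E)" for z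
  proof -
    have "(\<integral>\<^sup>+y. indicator K (z + y) \<partial>basis_measure E) =
      (\<integral>\<^sup>+y. indicator {y. z + y \<in> K} y \<partial>basis_measure E)"
      by (intro nn_integral_cong) (auto split: split_indicator)
    then show ?thesis by simp
  qed
  obtain r where r: "\<And>k. k \<in> K \<Longrightarrow> norm k \<le> r"
    using compact_imp_bounded[OF K] unfolding bounded_iff by blast
  obtain s where s: "\<And>n. norm (X n) \<le> s"
    using convergent_imp_bounded[OF lim] unfolding bounded_iff by blast
  have "c \<le> limsup (\<lambda>n. \<integral>\<^sup>+y. indicator K (X n + y) \<partial>basis_measure E)"
    using X by (intro le_Limsup) (auto simp: fib)
  also have "\<dots> \<le> (\<integral>\<^sup>+y. limsup (\<lambda>n. indicator K (X n + y)) \<partial>basis_measure E)"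
  proof (rule nn_integral_limsup[where w = "indicator (cball 0 (r + s))"])
    fix n
    have "norm y \<le> r + s" if "X n + y \<in> K" for y
      using r[OF that] s[of n] norm_triangle_ineq4[of "X n + y" "X n"] by simp
    then show "AE y in basis_measure E. indicator K (X n + y) \<le> (indicator (cball 0 (r + s)) y :: ennreal)"
      by (auto split: split_indicator)
    show "indicator (cball 0 (r + s)) \<in> borel_measurable (basis_measure E)"
      by (intro borel_measurable_indicator) (simp add: borel_closed)
    show "(\<integral>\<^sup>+y. indicator (cball 0 (r + s)) y \<partial>basis_measure E) < \<infinity>"
      using emeasure_basis_measure_bounded[OF E, of "cball 0 (r + s)"] by simp
  qed auto
  also have "\<dots> \<le> (\<integral>\<^sup>+y. indicator K (x + y) \<partial>basis_measure E)"
  proof (rule nn_integral_mono)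
    fix y
    show "limsup (\<lambda>n. indicator K (X n + y)) \<le> (indicator K (x + y) :: ennreal)"
    proof (cases "x + y \<in> K")
      case True
      then show ?thesis by (intro Limsup_bounded always_eventually) (auto split: split_indicator)
    next
      case False
      have "(\<lambda>n. X n + y) \<longlonglongrightarrow> x + y" by (intro tendsto_intros lim)
      moreover have "open (- K)" using K compact_imp_closed by blast
      ultimately have "\<forall>\<^sub>F n in sequentially. X n + y \<in> - K"
        using False by (intro topological_tendstoD) auto
      then show ?thesis by (intro Limsup_bounded) (auto elim: eventually_mono)
    qed
  qed
  finally show "x \<in> {x. c \<le> emeasure (basis_measure E) {y. x + y \<in> K}}" by (simp add: fib)
qed

section \<open>Compactness, separation and orthonormal bases in finite dimension\<close>

lemma compact_linear_combinations:
  fixes B :: "'a::real_normed_vector set"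
  assumes "finite B"
  shows "compact {\<Sum>b\<in>B. c b *\<^sub>R b |c. \<forall>b\<in>B. \<bar>c b\<bar> \<le> r}"
  using assms
proof induction
  case (insert b B)
  let ?T = "{\<Sum>b\<in>B. c b *\<^sub>R b |c. \<forall>b\<in>B. \<bar>c b\<bar> \<le> r}"
  have "compact ((\<lambda>t. t *\<^sub>R b) ` {-r..r})"
    by (intro compact_continuous_image continuous_intros compact_Icc)
  then have "compact {x + y |x y. x \<in> (\<lambda>t. t *\<^sub>R b) ` {-r..r} \<and> y \<in> ?T}"
    using insert.IH by (rule compact_sums)
  also have "{x + y |x y. x \<in> (\<lambda>t. t *\<^sub>R b) ` {-r..r} \<and> y \<in> ?T} =
    {\<Sum>b\<in>insert b B. c b *\<^sub>R b |c. \<forall>b\<in>insert b B. \<bar>c b\<bar> \<le> r}" (is "?L = ?R")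
  proof (intro equalityI subsetI)
    fix z assume "z \<in> ?L"
    then obtain t c where z: "z = t *\<^sub>R b + (\<Sum>b\<in>B. c b *\<^sub>R b)" "-r \<le> t" "t \<le> r" "\<forall>b\<in>B. \<bar>c b\<bar> \<le> r"
      by auto
    have "z = (\<Sum>b'\<in>insert b B. (c(b := t)) b' *\<^sub>R b')"
      using insert.hyps z(1) by (auto intro!: sum.cong)
    moreover have "\<forall>b'\<in>insert b B. \<bar>(c(b := t)) b'\<bar> \<le> r" using z by auto
    ultimately show "z \<in> ?R" by blast
  next
    fix z assume "z \<in> ?R"
    then obtain c where c: "z = c b *\<^sub>R b + (\<Sum>b\<in>B. c b *\<^sub>R b)" "\<bar>c b\<bar> \<le> r" "\<forall>b\<in>B. \<bar>c b\<bar> \<le> r"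
      using insert.hyps by auto
    then have "c b \<in> {-r..r}" by auto
    then show "z \<in> ?L" using c by blast
  qed
  finally show ?case .
qed simp

lemma compact_subset_span_orthonormal:
  fixes B :: "'a::real_inner set"
  assumes "orthonormal B" "closed X" "bounded X" "X \<subseteq> span B"
  shows "compact X"
proof -
  obtain r where r: "\<And>x. x \<in> X \<Longrightarrow> norm x \<le> r" using assms(3) bounded_iff by blast
  let ?T = "{\<Sum>b\<in>B. c b *\<^sub>R b |c. \<forall>b\<in>B. \<bar>c b\<bar> \<le> r}"
  have "X \<subseteq> ?T"
  proof
    fix x assume x: "x \<in> X"
    have "\<bar>x \<bullet> b\<bar> \<le> r" if "b \<in> B" for b
      using Cauchy_Schwarz_ineq2[of x b] r[OF x] assms(1) that by (simp add: orthonormal_def)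
    moreover have "x = (\<Sum>b\<in>B. (x \<bullet> b) *\<^sub>R b)"
      using span_orthonormal[OF assms(1)] x assms(4) by blast
    ultimately show "x \<in> ?T" by (intro CollectI exI[of _ "\<lambda>b. x \<bullet> b"]) auto
  qed
  then have "X = X \<inter> ?T" by blast
  then show ?thesis
    using closed_Int_compact[OF assms(2) compact_linear_combinations[of B r]] assms(1) by simp
qed

lemma orthonormal_basis_subspace_exists:
  fixes U :: "'a::real_inner set"
  assumes "subspace U" "U \<subseteq> span S" "finite S"
  obtains B where "orthonormal B" "span B = U"
proof -
  obtain A where A: "A \<subseteq> U" "independent A" "U \<subseteq> span A"
    by (rule basis_exists)
  have "finite A"
    using independent_span_bound[OF assms(3) A(2)] A(1) assms(2) by blast
  moreover have "span A = U" using A assms(1) span_minimal by blast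
  ultimately obtain C where C: "finite C" "span C = U" "pairwise orthogonal C"
    using basis_orthogonal[of A] by auto
  define B where "B = (\<lambda>x. x /\<^sub>R norm x) ` (C - {0})"
  have "pairwise orthogonal B"
  proof (rule pairwiseI)
    fix a b assume "a \<in> B" "b \<in> B" "a \<noteq> b"
    then obtain x y where xy: "x \<in> C" "y \<in> C" "a = x /\<^sub>R norm x" "b = y /\<^sub>R norm y" "x \<noteq> y"
      by (auto simp: B_def)
    then have "orthogonal x y" using C(3) by (auto simp: pairwise_def)
    then show "orthogonal a b" using xy by (simp add: orthogonal_def)
  qed
  then have "orthonormal B" using C(1) by (auto simp: orthonormal_def B_def)
  moreover have "span B = U"
  proof (rule antisym)
    have "B \<subseteq> span C" by (auto simp: B_def intro: span_scale span_base)
    then show "span B \<subseteq> U" using C(2) span_minimal[OF _ subspace_span] by blast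
    have "x \<in> span B" if "x \<in> C" for x
    proof (cases "x = 0")
      case False
      then have "x /\<^sub>R norm x \<in> span B" using that by (auto simp: B_def intro!: span_base)
      then have "norm x *\<^sub>R (x /\<^sub>R norm x) \<in> span B" by (rule span_scale)
      then show ?thesis using False by simp
    qed (simp add: span_zero)
    then show "U \<subseteq> span B" using C(2) span_minimal[OF _ subspace_span] by blast
  qed
  ultimately show ?thesis using that by blast
qed

text \<open>If \<open>w\<close> maximises the seminorm on the unit sphere, then \<open>N w\<close> times the inner product with \<open>w\<close> is a
  supporting functional of \<open>N\<close> at \<open>w\<close>. Indeed \<open>N (w - s * v)\<close> exceeds \<open>N w\<close> only in second order in \<open>s\<close>
  for \<open>v\<close> orthogonal to \<open>w\<close>, so by convexity \<open>N (w + v)\<close> cannot be below \<open>N w\<close>.\<close>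

lemma seminorm_maximal_direction:
  fixes N :: "'a::real_inner \<Rightarrow> real"
  assumes add: "\<And>x y. N (x + y) \<le> N x + N y" and scale: "\<And>c x. N (c *\<^sub>R x) = \<bar>c\<bar> * N x"
    and U: "subspace U" and w: "w \<in> U" "norm w = 1"
    and max: "\<And>u. u \<in> U \<Longrightarrow> N u \<le> N w * norm u"
    and u: "u \<in> U"
  shows "\<bar>u \<bullet> w\<bar> * N w \<le> N u"
proof -
  have nonneg: "0 \<le> N x" for x
    using add[of x "-x"] scale[of "-1" x] scale[of 0 0] by simp
  have perp: "N w \<le> N (w + v)" if v: "v \<in> U" "w \<bullet> v = 0" for v
  proof (rule field_le_epsilon)
    fix e :: real assume "e > 0"
    define q where "q = N w * (norm v)\<^sup>2"
    have "q \<ge> 0" by (simp add: q_def nonneg)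
    \<comment> \<open>the error \<open>s * q\<close> of the second order estimate has to be at most \<open>e\<close>\<close>
    define s where "s = e / (q + 1)"
    have "s > 0" using \<open>e > 0\<close> \<open>q \<ge> 0\<close> by (simp add: s_def)
    have "norm (w - s *\<^sub>R v) \<le> 1 + s\<^sup>2 * (norm v)\<^sup>2"
    proof -
      have "(norm (w - s *\<^sub>R v))\<^sup>2 = 1 + s\<^sup>2 * (norm v)\<^sup>2"
        using v w dot_square_norm[of w]
        by (simp add: power2_norm_eq_inner inner_diff inner_commute[of v w])
           (simp add: power2_eq_square)
      also have "\<dots> \<le> (1 + s\<^sup>2 * (norm v)\<^sup>2)\<^sup>2"
        by (intro self_le_power) auto
      finally show ?thesis by (rule power2_le_imp_le) simp
    qed
    then have "N (w - s *\<^sub>R v) \<le> N w * (1 + s\<^sup>2 * (norm v)\<^sup>2)"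
      using max[of "w - s *\<^sub>R v"] v w U nonneg[of w]
      by (meson mult_left_mono order_trans subspace_diff subspace_scale)
    moreover have "(1 + s) *\<^sub>R w = s *\<^sub>R (w + v) + (w - s *\<^sub>R v)"
      by (simp add: algebra_simps)
    then have "(1 + s) * N w \<le> s * N (w + v) + N (w - s *\<^sub>R v)"
      using add[of "s *\<^sub>R (w + v)" "w - s *\<^sub>R v"] scale[of "1 + s" w] scale[of s "w + v"] \<open>s > 0\<close>
      by simp
    ultimately have "s * N w \<le> s * (N (w + v) + s * q)"
      by (simp add: q_def algebra_simps power2_eq_square)
    then have "N w \<le> N (w + v) + s * q" using \<open>s > 0\<close> by simp
    moreover have "s * q \<le> e"
      using \<open>e > 0\<close> \<open>q \<ge> 0\<close> by (simp add: s_def field_simps)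
    ultimately show "N w \<le> N (w + v) + e" by simp
  qed
  show ?thesis
  proof (cases "u \<bullet> w = 0")
    case False
    define v where "v = (1 / (u \<bullet> w)) *\<^sub>R u - w"
    have "v \<in> U" unfolding v_def by (intro subspace_diff subspace_scale U u w)
    moreover have "w \<bullet> v = 0"
      using False w by (simp add: v_def inner_diff_right inner_commute[of w u] dot_square_norm)
    ultimately have "N w \<le> N (w + v)" by (rule perp)
    also have "w + v = (1 / (u \<bullet> w)) *\<^sub>R u" by (simp add: v_def)
    finally show ?thesis using False by (simp add: scale field_simps)
  qed (simp add: nonneg)
qed

text \<open>Greedy choice: \<open>w\<close> maximises \<open>N\<close> on the unit sphere, and the rest of the basis is chosen in the
  orthogonal complement of \<open>w\<close>. Removing the component along \<open>w\<close> from \<open>u\<close> at most doubles \<open>N u\<close>, by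
  the previous lemma, and this is where the powers of \<open>2\<close> come from.\<close>

lemma seminorm_almost_diagonal_basis:
  fixes N :: "'a::real_inner \<Rightarrow> real"
  assumes add: "\<And>x y. N (x + y) \<le> N x + N y" and scale: "\<And>c x. N (c *\<^sub>R x) = \<bar>c\<bar> * N x"
    and bound: "\<And>x. N x \<le> L * norm x"
    and B0: "orthonormal B0"
  shows "\<exists>B. orthonormal B \<and> span B = span B0 \<and>
    (\<forall>u\<in>span B0. \<forall>b\<in>B. \<bar>u \<bullet> b\<bar> * N b \<le> 2 ^ card B0 * N u)"
  using B0
proof (induction "card B0" arbitrary: B0)
  case 0
  then show ?case by (intro exI[of _ "{}"]) (auto simp: orthonormal_def pairwise_def)
next
  case (Suc n)
  note B0 = \<open>orthonormal B0\<close>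
  define U where "U = span B0"
  have subU: "subspace U" by (simp add: U_def)
  have nonneg: "0 \<le> N x" for x
    using add[of x "-x"] scale[of "-1" x] scale[of 0 0] by simp
  have cont: "continuous_on A N" for A
  proof (rule continuous_onI)
    fix x e :: real assume "e > 0"
    show "\<exists>d>0. \<forall>x'\<in>A. dist x' x < d \<longrightarrow> dist (N x') (N x) \<le> e" for x
    proof (intro exI[of _ "e / (\<bar>L\<bar> + 1)"] conjI ballI impI)
      fix x' assume x': "dist x' x < e / (\<bar>L\<bar> + 1)"
      have "N x' \<le> N (x' - x) + N x" "N x \<le> N (x - x') + N x'"
        using add[of "x' - x" x] add[of "x - x'" x'] by auto
      moreover have "N (x - x') = N (x' - x)" using scale[of "-1" "x' - x"] by simp
      ultimately have "\<bar>N x' - N x\<bar> \<le> N (x' - x)" by linarith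
      also have "\<dots> \<le> (\<bar>L\<bar> + 1) * norm (x' - x)"
        by (rule order_trans[OF bound]) (intro mult_right_mono, auto)
      also have "\<dots> \<le> e" using x' by (simp add: dist_norm field_simps)
      finally show "dist (N x') (N x) \<le> e" by (simp add: dist_real_def)
    qed (use \<open>e > 0\<close> in simp)
  qed
  obtain w where w: "w \<in> U" "norm w = 1" and wmax: "\<And>u. u \<in> U \<Longrightarrow> norm u = 1 \<Longrightarrow> N u \<le> N w"
  proof -
    have "closed (sphere (0::'a) 1)"
      by (simp add: sphere_def closed_Collect_eq continuous_intros)
    then have "compact (U \<inter> sphere 0 1)"
      unfolding U_def using closed_span_orthonormal[OF B0]
      by (intro compact_subset_span_orthonormal[OF B0] closed_Int)
         (auto intro: bounded_subset[OF bounded_cball[of 0 1]])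
    moreover obtain b where "b \<in> B0" using Suc(2) by fastforce
    then have "b \<in> U \<inter> sphere 0 1" using B0 by (auto simp: U_def orthonormal_def span_base)
    ultimately obtain x where "x \<in> U \<inter> sphere 0 1" "\<And>u. u \<in> U \<inter> sphere 0 1 \<Longrightarrow> N u \<le> N x"
      using continuous_attains_sup[OF _ _ cont, of "U \<inter> sphere 0 1"] by blast
    then show thesis by (intro that[of x]) auto
  qed
  have max: "N u \<le> N w * norm u" if "u \<in> U" for u
  proof (cases "u = 0")
    case False
    have "N (u /\<^sub>R norm u) \<le> N w" using that subU False by (intro wmax subspace_scale) auto
    then show ?thesis using False by (simp add: scale field_simps)
  qed (use scale[of 0 0] in simp)
  have diag: "\<bar>u \<bullet> w\<bar> * N w \<le> N u" if "u \<in> U" for u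
    using seminorm_maximal_direction[OF add scale subU w max that] .
  define U' where "U' = U \<inter> {x. x \<bullet> w = 0}"
  have "subspace U'"
    unfolding U'_def using subU by (auto simp: subspace_def inner_add_left)
  have ins: "orthonormal (insert w B)" "span (insert w B) = U" "w \<notin> B"
    if B: "orthonormal B" "span B = U'" for B
  proof -
    have sub: "B \<subseteq> U'" using B span_base by blast
    then show "w \<notin> B" using w by (auto simp: U'_def)
    show "orthonormal (insert w B)"
      using B(1) sub w by (auto simp: orthonormal_def pairwise_insert orthogonal_def U'_def inner_commute)
    show "span (insert w B) = U"
    proof (rule antisym)
      show "span (insert w B) \<subseteq> U" using sub w subU by (intro span_minimal) (auto simp: U'_def)
      show "U \<subseteq> span (insert w B)"
      proof
        fix u assume u: "u \<in> U"
        have "u - (u \<bullet> w) *\<^sub>R w \<in> U'"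
          using u w subU by (auto simp: U'_def inner_diff_left dot_square_norm intro: subspace_diff subspace_scale)
        then show "u \<in> span (insert w B)" using B(2) by (auto simp: span_insert)
      qed
    qed
  qed
  obtain B1 where B1: "orthonormal B1" "span B1 = U'"
    using orthonormal_basis_subspace_exists[OF \<open>subspace U'\<close>, of B0] B0 by (auto simp: U'_def U_def)
  have "card (insert w B1) = card B0"
    using orthonormal_card[OF ins(1)[OF B1]] orthonormal_card[OF B0] ins(2)[OF B1] by (simp add: U_def)
  then have "n = card B1" using ins(3)[OF B1] B1(1) Suc(2) by simp
  from Suc(1)[OF this B1(1)] obtain B where B: "orthonormal B" "span B = U'"
    and IH: "\<And>u b. u \<in> U' \<Longrightarrow> b \<in> B \<Longrightarrow> \<bar>u \<bullet> b\<bar> * N b \<le> 2 ^ n * N u"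
    using B1 \<open>n = card B1\<close> by auto
  have "\<bar>u \<bullet> b\<bar> * N b \<le> 2 ^ card B0 * N u" if u: "u \<in> U" and b: "b \<in> insert w B" for u b
  proof (cases "b = w")
    case True
    have "N u * 1 \<le> N u * 2 ^ card B0" by (intro mult_left_mono nonneg) simp
    then show ?thesis using diag[OF u] True by (simp add: mult.commute)
  next
    case False
    define u' where "u' = u - (u \<bullet> w) *\<^sub>R w"
    have "u' \<in> U'"
      using u w subU by (auto simp: u'_def U'_def inner_diff_left dot_square_norm intro: subspace_diff subspace_scale)
    have "b \<in> B" using b False by simp
    then have "w \<bullet> b = 0" using B span_base by (auto simp: U'_def inner_commute)
    then have "u \<bullet> b = u' \<bullet> b" by (simp add: u'_def inner_diff_left)
    then have "\<bar>u \<bullet> b\<bar> * N b \<le> 2 ^ n * N u'" using IH[OF \<open>u' \<in> U'\<close> \<open>b \<in> B\<close>] by simp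
    also have "N u' \<le> N u + \<bar>u \<bullet> w\<bar> * N w"
      using add[of u "(- (u \<bullet> w)) *\<^sub>R w"] scale[of "- (u \<bullet> w)" w] by (simp add: u'_def)
    also have "\<dots> \<le> 2 * N u" using diag[OF u] by simp
    finally show ?thesis using \<open>Suc n = card B0\<close>[symmetric] by simp
  qed
  then show ?case using ins[OF B] by (intro exI[of _ "insert w B"]) (auto simp: U_def)
qed

lemma midpoint_iterate:
  fixes A :: "'a::real_vector set"
  assumes mid: "\<And>x y. x \<in> A \<Longrightarrow> y \<in> A \<Longrightarrow> (1/2) *\<^sub>R (x + y) \<in> A" and "p \<in> A" "y \<in> A"
  shows "p + (1 / 2 ^ k) *\<^sub>R (y - p) \<in> A"
proof (induction k)
  case (Suc k)
  have "(1/2) *\<^sub>R (p + (p + (1 / 2 ^ k) *\<^sub>R (y - p))) = p + (1 / 2 ^ Suc k) *\<^sub>R (y - p)"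
    by (simp add: scaleR_add_right flip: scaleR_half_double)
       (simp add: scaleR_add_left[symmetric] add.assoc[symmetric])
  then show ?case using mid[OF \<open>p \<in> A\<close> Suc] by metis
qed (use \<open>y \<in> A\<close> in simp)

text \<open>The nearest point of \<open>A\<close> gives the separating functional. Points \<open>p + (y - p) / 2 ^ k\<close> replace the
  segments that are used for convex sets. For empty \<open>A\<close> the witness is \<open>0\<close>.\<close>

lemma midpoint_convex_separation:
  fixes A :: "'a::real_inner set"
  assumes "compact A" and mid: "\<And>x y. x \<in> A \<Longrightarrow> y \<in> A \<Longrightarrow> (1/2) *\<^sub>R (x + y) \<in> A" and "x \<notin> A"
    and "U \<supseteq> insert x A" "subspace U"
  shows "\<exists>u\<in>U. \<forall>y\<in>A. y \<bullet> u < x \<bullet> u"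
proof (cases "A = {}")
  case True
  then show ?thesis using assms(5) subspace_0 by blast
next
  case False
  have "continuous_on A (\<lambda>y. dist x y)" by (intro continuous_intros)
  then obtain p where p: "p \<in> A" "\<And>y. y \<in> A \<Longrightarrow> dist x p \<le> dist x y"
    using continuous_attains_inf[OF assms(1) False] by blast
  have sep: "(y - p) \<bullet> (x - p) \<le> 0" if y: "y \<in> A" for y
  proof (rule ccontr)
    define c where "c = (y - p) \<bullet> (x - p)"
    assume "\<not> (y - p) \<bullet> (x - p) \<le> 0"
    then have "c > 0" by (simp add: c_def)
    have *: "2 * c \<le> (1 / 2) ^ k * (norm (y - p))\<^sup>2" for k
    proof -
      define t :: real where "t = (1 / 2) ^ k"
      have "t > 0" by (simp add: t_def)
      have "p + t *\<^sub>R (y - p) \<in> A"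
        using midpoint_iterate[OF mid p(1) y, of k] by (simp add: t_def power_one_over)
      then have "(norm (x - p))\<^sup>2 \<le> (norm (x - (p + t *\<^sub>R (y - p))))\<^sup>2"
        using p(2) by (intro power_mono) (auto simp: dist_norm)
      also have "x - (p + t *\<^sub>R (y - p)) = (x - p) - t *\<^sub>R (y - p)" by simp
      also have "(norm ((x - p) - t *\<^sub>R (y - p)))\<^sup>2 = (norm (x - p))\<^sup>2 - 2 * t * c + t * t * (norm (y - p))\<^sup>2"
        unfolding power2_norm_eq_inner c_def
        by (simp only: inner_diff_left[of "x - p"] inner_diff_right[of _ "x - p"] inner_scaleR_left inner_scaleR_right
            inner_commute[of "x - p" "y - p"]) (simp add: algebra_simps)
      finally have "t * (2 * c) \<le> t * (t * (norm (y - p))\<^sup>2)" by (simp add: algebra_simps)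
      then show ?thesis using \<open>t > 0\<close> by (simp add: t_def)
    qed
    have "(\<lambda>k. (1 / 2) ^ k * (norm (y - p))\<^sup>2) \<longlonglongrightarrow> 0 * (norm (y - p))\<^sup>2"
      by (intro tendsto_mult LIMSEQ_power_zero tendsto_const) simp
    then have "2 * c \<le> 0"
      using * by (intro LIMSEQ_le_const[of _ 0 "2 * c"]) auto
    then show False using \<open>c > 0\<close> by simp
  qed
  have "x \<noteq> p" using p(1) assms(3) by blast
  then have "0 < (x - p) \<bullet> (x - p)" by simp
  then have "y \<bullet> (x - p) < x \<bullet> (x - p)" if "y \<in> A" for y
    using sep[OF that] by (simp add: inner_diff_left)
  moreover have "x - p \<in> U" using assms(4,5) p(1) by (intro subspace_diff) auto
  ultimately show ?thesis by blast
qed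

section \<open>Half-lines carrying mass under a centred log-concave law\<close>

lemma (in prob_space) markov_relative_to_mean_abs:
  assumes [simp]: "integrable M Z" and "R > 0"
  shows "prob {x \<in> space M. R * expectation (\<lambda>x. \<bar>Z x\<bar>) < \<bar>Z x\<bar>} \<le> 1 / R"
proof -
  define m where "m = expectation (\<lambda>x. \<bar>Z x\<bar>)"
  have [measurable]: "random_variable borel Z" by (rule borel_measurable_integrable) simp
  have "m \<ge> 0" by (simp add: m_def)
  show ?thesis
  proof (cases "m = 0")
    case True
    then have "AE x in M. \<bar>Z x\<bar> = 0"
      using integral_nonneg_eq_0_iff_AE[of M "\<lambda>x. \<bar>Z x\<bar>"] by (simp add: m_def)
    then have "AE x in M. x \<notin> {x \<in> space M. R * m < \<bar>Z x\<bar>}"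
      using True by (auto elim: eventually_mono)
    then have "prob {x \<in> space M. R * m < \<bar>Z x\<bar>} = 0"
      by (subst prob_eq_0) auto
    then show ?thesis using \<open>R > 0\<close> by (simp add: m_def)
  next
    case False
    with \<open>m \<ge> 0\<close> have "m > 0" by simp
    have "prob {x \<in> space M. R * m < \<bar>Z x\<bar>} \<le> prob {x \<in> space M. R * m \<le> \<bar>Z x\<bar>}"
      by (intro finite_measure_mono) auto
    also have "\<dots> \<le> m / (R * m)"
      unfolding m_def
      using integral_Markov_inequality_measure[where u = "\<lambda>x. \<bar>Z x\<bar>" and c = "R * m" and A = "{}" and M = M]
        \<open>m > 0\<close> \<open>R > 0\<close> by (simp add: m_def)
    finally show ?thesis using False by (simp add: m_def)
  qed
qed

text \<open>Suppose that \<open>Z\<close> exceeds a quarter of its mean absolute value \<open>m\<close> with probability less than \<open>1/16\<close>.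
  Since \<open>Z \<ge> - 2 * m\<close> with probability at least \<open>1/2\<close>, log-concavity makes the tail decay at least by
  the factor \<open>8\<close> over each further interval of length \<open>9/4 * m\<close>. Then the positive part of \<open>Z\<close> has
  mean less than \<open>m / 2\<close>, whereas centring forces equality.\<close>

lemma (in prob_space) centered_log_concave_tail:
  fixes Z :: "'a \<Rightarrow> real"
  assumes [measurable]: "random_variable borel Z"
    and bdd: "AE x in M. \<bar>Z x\<bar> \<le> c" and centered: "expectation Z = 0"
    and logc: "\<And>r s. prob {x \<in> space M. r \<le> Z x} * prob {x \<in> space M. s \<le> Z x} \<le>
      (prob {x \<in> space M. (r + s) / 2 \<le> Z x})\<^sup>2"
  shows "1 / 16 \<le> prob {x \<in> space M. expectation (\<lambda>x. \<bar>Z x\<bar>) / 4 \<le> Z x}"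
proof (rule ccontr)
  define q where "q r = prob {x \<in> space M. r \<le> Z x}" for r
  define m where "m = expectation (\<lambda>x. \<bar>Z x\<bar>)"
  assume "\<not> ?thesis"
  then have small: "q (m / 4) < 1 / 16" by (simp add: q_def m_def)
  have intZ [simp]: "integrable M Z"
    using bdd by (intro integrable_const_bound[of _ c]) auto
  have mono: "q s \<le> q r" if "r \<le> s" for r s
    unfolding q_def using that by (intro finite_measure_mono) auto
  have "m \<ge> 0" by (simp add: m_def)
  moreover have "m \<noteq> 0"
  proof
    assume m0: "m = 0"
    then have "AE x in M. \<bar>Z x\<bar> = 0"
      using integral_nonneg_eq_0_iff_AE[of M "\<lambda>x. \<bar>Z x\<bar>"] by (simp add: m_def)
    then have "AE x in M. x \<in> {x \<in> space M. m / 4 \<le> Z x}"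
      using m0 by (auto elim: eventually_mono)
    then have "q (m / 4) = 1" unfolding q_def by (subst prob_eq_1) auto
    then show False using small by simp
  qed
  ultimately have "m > 0" by simp
  have q0: "1 / 2 \<le> q (- 2 * m)"
  proof -
    have "prob {x \<in> space M. 2 * m < \<bar>Z x\<bar>} \<le> 1 / 2"
      using markov_relative_to_mean_abs[OF intZ, of 2] by (simp add: m_def)
    moreover have "prob (space M - {x \<in> space M. - 2 * m \<le> Z x}) \<le> prob {x \<in> space M. 2 * m < \<bar>Z x\<bar>}"
      by (intro finite_measure_mono) auto
    ultimately show ?thesis unfolding q_def by (subst (asm) prob_compl) auto
  qed
  \<comment> \<open>the distance from \<open>- 2 * m\<close> to \<open>m / 4\<close>, so that \<open>m / 4\<close> is the midpoint of \<open>- 2 * m\<close> and \<open>m / 4 + L\<close>\<close>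
  define L where "L = 9 / 4 * m"
  define Q where "Q k = q (m / 4 + real k * L)" for k
  have ratio: "Q (Suc k) \<le> Q k / 8" for k
  proof (induction k)
    case 0
    have eq: "(m / 4 + L + - 2 * m) / 2 = m / 4" by (simp add: L_def)
    then have "Q 1 * q (- 2 * m) \<le> (Q 0)\<^sup>2"
      using logc[of "m / 4 + L" "- 2 * m", folded q_def, unfolded eq] by (simp add: Q_def)
    moreover have "Q 1 * (1 / 2) \<le> Q 1 * q (- 2 * m)"
      using q0 by (intro mult_left_mono) (auto simp: Q_def q_def)
    moreover have "Q 0 * Q 0 \<le> Q 0 * (1 / 16)"
      using small by (intro mult_left_mono) (auto simp: Q_def q_def)
    ultimately show ?case by (simp add: power2_eq_square)
  next
    case (Suc k)
    have eq: "(m / 4 + real k * L + (m / 4 + real (Suc (Suc k)) * L)) / 2 = m / 4 + real (Suc k) * L"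
      by (simp add: field_simps)
    then have *: "Q k * Q (Suc (Suc k)) \<le> (Q (Suc k))\<^sup>2"
      using logc[of "m / 4 + real k * L" "m / 4 + real (Suc (Suc k)) * L", folded q_def, unfolded eq]
      by (simp only: Q_def)
    have nn: "0 \<le> Q k" "0 \<le> Q (Suc k)" by (auto simp: Q_def q_def)
    show ?case
    proof (cases "Q k = 0")
      case True
      have "Q (Suc (Suc k)) \<le> Q k"
        unfolding Q_def using \<open>m > 0\<close> by (intro mono) (simp add: L_def)
      then show ?thesis using True nn by simp
    next
      case False
      have "Q (Suc k) * Q (Suc k) \<le> Q (Suc k) * (Q k / 8)" by (intro mult_left_mono Suc nn)
      then have "Q k * Q (Suc (Suc k)) \<le> Q k * (Q (Suc k) / 8)"
        using * by (simp add: power2_eq_square mult.commute)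
      then show ?thesis using False nn by simp
    qed
  qed
  have Qle: "Q k \<le> q (m / 4) * (1 / 8) ^ k" for k
  proof (induction k)
    case (Suc k)
    then show ?case using ratio[of k] by simp
  qed (simp add: Q_def)
  obtain K :: nat where K: "c < m / 4 + real K * L"
  proof -
    obtain K :: nat where "(c - m / 4) / L < real K" using reals_Archimedean2 by blast
    then show thesis using \<open>m > 0\<close> that[of K] by (simp add: L_def field_simps)
  qed
  \<comment> \<open>layer cake with steps of length \<open>L\<close>, each step counted in full\<close>
  have layers: "max (z - m / 4) 0 \<le> (\<Sum>k<n. L * indicator {x. m / 4 + real k * L \<le> x} z)"
    if "z < m / 4 + real n * L" for z n
    using that
  proof (induction n)
    case (Suc n)
    show ?case
    proof (cases "z < m / 4 + real n * L")
      case True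
      have "(0::real) \<le> L * indicator {x. m / 4 + real n * L \<le> x} z"
        using \<open>m > 0\<close> by (simp add: L_def)
      then show ?thesis using Suc.IH[OF True] by simp
    next
      case False
      have "(\<Sum>k<Suc n. L * indicator {x. m / 4 + real k * L \<le> x} z) = (\<Sum>k<Suc n. L)"
      proof (intro sum.cong refl)
        fix k assume "k \<in> {..<Suc n}"
        then have "real k * L \<le> real n * L" using \<open>m > 0\<close> by (simp add: L_def)
        then show "L * indicator {x. m / 4 + real k * L \<le> x} z = L" using False by simp
      qed
      also have "\<dots> = real (Suc n) * L" by simp
      finally have eq: "(\<Sum>k<Suc n. L * indicator {x. m / 4 + real k * L \<le> x} z) = real (Suc n) * L" .
      have "0 \<le> real (Suc n) * L" using \<open>m > 0\<close> by (simp add: L_def)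
      then show ?thesis using Suc.prems unfolding eq by linarith
    qed
  qed simp
  have int: "integrable M (\<lambda>x. L * indicator {x \<in> space M. r \<le> Z x} x)" for r
    by (intro integrable_mult_right integrable_real_indicator) (auto simp: less_top[symmetric])
  have "m / 4 = expectation (\<lambda>x. (\<bar>Z x\<bar> + Z x) / 2 - m / 4)"
    by (simp add: centered prob_space flip: m_def)
  also have "\<dots> \<le> expectation (\<lambda>x. \<Sum>k<K. L * indicator {x \<in> space M. m / 4 + real k * L \<le> Z x} x)"
  proof (rule integral_mono_AE)
    show "AE x in M. (\<bar>Z x\<bar> + Z x) / 2 - m / 4 \<le>
      (\<Sum>k<K. L * indicator {x \<in> space M. m / 4 + real k * L \<le> Z x} x)"
      using bdd AE_space
    proof eventually_elim
      case (elim x)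
      then have "max (Z x - m / 4) 0 \<le> (\<Sum>k<K. L * indicator {x. m / 4 + real k * L \<le> x} (Z x))"
        using K by (intro layers) auto
      also have "\<dots> = (\<Sum>k<K. L * indicator {x \<in> space M. m / 4 + real k * L \<le> Z x} x)"
        using elim by (intro sum.cong) (auto split: split_indicator)
      finally show ?case using \<open>m > 0\<close> by (simp add: max_def abs_if split: if_splits)
    qed
    show "integrable M (\<lambda>x. \<Sum>k<K. L * indicator {x \<in> space M. m / 4 + real k * L \<le> Z x} x)"
      by (intro Bochner_Integration.integrable_sum int)
  qed simp
  also have "\<dots> = (\<Sum>k<K. L * Q k)"
    by (subst Bochner_Integration.integral_sum[OF int]) (auto simp: Q_def q_def intro!: sum.cong)
  also have "\<dots> \<le> (\<Sum>k<K. L * (q (m / 4) * (1 / 8) ^ k))"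
    using \<open>m > 0\<close> Qle by (intro sum_mono mult_left_mono) (auto simp: L_def)
  also have "\<dots> = L * q (m / 4) * (\<Sum>k<K. (1 / 8) ^ k)"
    by (simp add: sum_distrib_left mult.assoc)
  also have "\<dots> \<le> L * q (m / 4) * (8 / 7)"
  proof (rule mult_left_mono)
    show "(\<Sum>k<K. (1 / 8 :: real) ^ k) \<le> 8 / 7"
      by (subst sum_gp_strict) (auto simp: field_simps)
    show "0 \<le> L * q (m / 4)" using \<open>m > 0\<close> by (simp add: L_def q_def)
  qed
  also have "\<dots> \<le> L * (1 / 16) * (8 / 7)"
    using small \<open>m > 0\<close> by (simp add: L_def)
  also have "\<dots> < m / 4" using \<open>m > 0\<close> by (simp add: L_def)
  finally show False by simp
qed

section \<open>Mean absolute values of linear functionals\<close>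

lemma integral_uniform_measure:
  fixes f :: "'a \<Rightarrow> real"
  assumes f: "f \<in> borel_measurable M" and A: "emeasure M A \<noteq> 0" "emeasure M A \<noteq> \<infinity>"
  shows "(LINT x|uniform_measure M A. f x) = (LINT x:A|M. f x) / measure M A"
proof -
  have [measurable]: "A \<in> sets M" by (rule emeasure_neq_0_sets[OF A(1)])
  have mA: "0 < measure M A"
    using A by (simp add: measure_def enn2real_positive_iff less_top zero_less_iff_neq_zero)
  have "indicator A x / emeasure M A = ennreal (indicator A x / measure M A)" for x
    using A mA by (auto simp: emeasure_eq_ennreal_measure divide_ennreal split: split_indicator)
      (metis divide_ennreal ennreal_1 zero_le_one)
  then have "uniform_measure M A = density M (\<lambda>x. ennreal (indicator A x / measure M A))"
    by (simp add: uniform_measure_def)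
  then have "(LINT x|uniform_measure M A. f x) = (LINT x|M. (indicator A x / measure M A) * f x)"
    using f by (simp add: integral_density)
  also have "\<dots> = (LINT x:A|M. f x) / measure M A"
    unfolding set_lebesgue_integral_def
    by (subst integral_divide_zero[symmetric]) (simp add: mult.commute)
  finally show ?thesis .
qed

definition mean_abs :: "'a::real_inner measure \<Rightarrow> 'a \<Rightarrow> real" where
  "mean_abs P u = (LINT x|P. \<bar>x \<bullet> u\<bar>)"

lemma
  fixes P :: "'a::{real_inner,second_countable_topology} measure"
  assumes "prob_space P" and sets: "sets P = sets borel" and bdd: "AE x in P. norm x \<le> L"
  shows mean_abs_add: "mean_abs P (u + v) \<le> mean_abs P u + mean_abs P v"
    and mean_abs_scaleR: "mean_abs P (c *\<^sub>R u) = \<bar>c\<bar> * mean_abs P u"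
    and mean_abs_le_norm: "mean_abs P u \<le> L * norm u"
proof -
  interpret prob_space P by fact
  note [measurable_cong] = sets
  have le: "AE x in P. \<bar>x \<bullet> u\<bar> \<le> L * norm u" for u
    using bdd by (auto elim!: eventually_mono intro: order_trans[OF Cauchy_Schwarz_ineq2 mult_right_mono])
  then have int: "integrable P (\<lambda>x. \<bar>x \<bullet> u\<bar>)" for u
    by (intro integrable_const_bound[of _ "L * norm u"]) auto
  show "mean_abs P u \<le> L * norm u"
    unfolding mean_abs_def by (rule integral_le_const[OF int le])
  have "mean_abs P (u + v) \<le> (LINT x|P. \<bar>x \<bullet> u\<bar> + \<bar>x \<bullet> v\<bar>)"
    unfolding mean_abs_def
    by (rule integral_mono[OF int Bochner_Integration.integrable_add[OF int int]])
       (auto simp: inner_add_right)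
  then show "mean_abs P (u + v) \<le> mean_abs P u + mean_abs P v"
    unfolding mean_abs_def by (simp add: int)
  show "mean_abs P (c *\<^sub>R u) = \<bar>c\<bar> * mean_abs P u"
    unfolding mean_abs_def by (simp add: abs_mult)
qed

section \<open>Fibres of a centred body in an almost diagonal basis\<close>

text \<open>In the application \<open>W\<close> is an orthonormal basis of \<open>H\<close> and \<open>E\<close> one of its orthogonal complement, so
  that the measure is Lebesgue measure on \<open>\<real>\<^sup>n\<close>; \<open>diagonal\<close> is the property of the greedy basis.\<close>

locale centered_body =
  fixes W E K :: "'a::{real_inner,second_countable_topology} set"
  assumes orth: "orthonormal (W \<union> E)" and disj: "W \<inter> E = {}"
    and K_compact: "compact K" and K_convex: "convex K"
    and pos: "emeasure (basis_measure (W \<union> E)) K \<noteq> 0"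
    and mean_zero: "u \<in> span W \<Longrightarrow> (LINT x|uniform_measure (basis_measure (W \<union> E)) K. x \<bullet> u) = 0"
    and diagonal: "u \<in> span W \<Longrightarrow> b \<in> W \<Longrightarrow>
      \<bar>u \<bullet> b\<bar> * mean_abs (uniform_measure (basis_measure (W \<union> E)) K) b \<le>
      2 ^ card W * mean_abs (uniform_measure (basis_measure (W \<union> E)) K) u"
    and W_nonempty: "W \<noteq> {}"
begin

abbreviation \<mu> :: "'a measure" where "\<mu> \<equiv> basis_measure (W \<union> E)"
abbreviation P :: "'a measure" where "P \<equiv> uniform_measure \<mu> K"
abbreviation N :: "'a \<Rightarrow> real" where "N \<equiv> mean_abs P"

definition fibre_volume :: "'a \<Rightarrow> real" where
  "fibre_volume x = measure (basis_measure E) {y. x + y \<in> K}"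

lemma orthW: "orthonormal W" and orthE: "orthonormal E"
  using orth orthonormal_subset by blast+

lemma finW [simp]: "finite W" and finE [simp]: "finite E"
  using orthW orthE by simp_all

lemma K_borel [measurable]: "K \<in> sets borel"
  using K_compact by (simp add: compact_imp_closed)

lemma K_finite: "emeasure \<mu> K \<noteq> \<infinity>"
  using emeasure_basis_measure_bounded[OF orth compact_imp_bounded[OF K_compact]] by simp

sublocale prob_space P
  using pos K_finite by (rule prob_space_uniform_measure)

lemma P_eq: "A \<in> sets borel \<Longrightarrow> prob A = measure \<mu> (K \<inter> A) / measure \<mu> K"
  using pos K_finite by simp

lemma volume_pos: "0 < measure \<mu> K"
  using pos K_finite by (simp add: measure_def enn2real_positive_iff less_top zero_less_iff_neq_zero)

lemma AE_K: "AE x in P. x \<in> K"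
  by (intro AE_uniform_measureI) auto

lemma inner_bounded: "\<exists>r. \<forall>x\<in>K. \<bar>x \<bullet> u\<bar> \<le> r"
proof -
  obtain r where r: "\<And>x. x \<in> K \<Longrightarrow> norm x \<le> r"
    using compact_imp_bounded[OF K_compact] unfolding bounded_iff by blast
  have "\<bar>x \<bullet> u\<bar> \<le> r * norm u" if "x \<in> K" for x
    using order_trans[OF Cauchy_Schwarz_ineq2 mult_right_mono[OF r[OF that] norm_ge_zero[of u]]] .
  then show ?thesis by blast
qed

lemma integrable_inner [simp]: "integrable P (\<lambda>x. x \<bullet> u)"
proof -
  obtain r where "\<forall>x\<in>K. \<bar>x \<bullet> u\<bar> \<le> r" using inner_bounded by blast
  then have "AE x in P. norm (x \<bullet> u) \<le> r" using AE_K by (auto elim: eventually_mono)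
  then show ?thesis by (rule integrable_const_bound) measurable
qed

text \<open>Points of a fibre differ by vectors of the span of \<open>E\<close>, on which functionals from the span of \<open>W\<close>
  vanish; hence the half-spaces and the box below are unions of fibres.\<close>

lemma inner_orthogonal_parts: "x \<in> span W \<Longrightarrow> y \<in> span E \<Longrightarrow> y \<bullet> x = 0"
proof -
  assume "x \<in> span W" "y \<in> span E"
  moreover have "e \<bullet> w = 0" if "e \<in> E" "w \<in> W" for e w
    using orthonormal_inner[OF orth, of e w] that disj by auto
  ultimately have "orthogonal y x"
    using orthogonal_to_span[of x W y] orthogonal_to_span[of y E x]
    by (meson orthogonal_commute orthogonal_def orthogonal_to_span)
  then show ?thesis by (simp add: orthogonal_def)
qed

text \<open>The parts of \<open>K\<close> on one side of parallel hyperplanes satisfy the Brunn-Minkowski inequality, so the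
  marginal of \<open>K\<close> along \<open>u\<close> has a log-concave tail function.\<close>

lemma halfspace_mass:
  assumes "u \<in> span W" shows "1 / 16 \<le> prob {x. N u / 4 \<le> x \<bullet> u}"
proof -
  obtain r where r: "\<forall>x\<in>K. \<bar>x \<bullet> u\<bar> \<le> r" using inner_bounded by blast
  have "1 / 16 \<le> prob {x \<in> space P. expectation (\<lambda>x. \<bar>x \<bullet> u\<bar>) / 4 \<le> x \<bullet> u}"
  proof (rule centered_log_concave_tail[where c = r])
    show "AE x in P. \<bar>x \<bullet> u\<bar> \<le> r" using AE_K r by (auto elim: eventually_mono)
    fix s t :: real
    define H where "H s = K \<inter> {x. s \<le> x \<bullet> u}" for s
    have [measurable]: "H s \<in> sets borel" for s unfolding H_def by measurable
    have fin: "emeasure \<mu> (H s) < \<infinity>" for s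
      using emeasure_basis_measure_bounded[OF orth, of "H s"] compact_imp_bounded[OF K_compact]
      by (auto simp: H_def intro: bounded_Int)
    have "emeasure \<mu> (H s) * emeasure \<mu> (H t) \<le> (emeasure \<mu> (H ((s + t) / 2)))\<^sup>2"
    proof (rule brunn_minkowski_midpoint)
      fix x y assume "x \<in> H s" "y \<in> H t"
      then show "(1/2) *\<^sub>R (x + y) \<in> H ((s + t) / 2)"
        using convexD[OF K_convex, of x y "1/2" "1/2"]
        by (auto simp: H_def scaleR_add_right inner_add_left)
    qed auto
    then have "measure \<mu> (H s) * measure \<mu> (H t) \<le> (measure \<mu> (H ((s + t) / 2)))\<^sup>2"
      using fin by (simp add: emeasure_eq_ennreal_measure less_top ennreal_power flip: ennreal_mult)
    then show "prob {x \<in> space P. s \<le> x \<bullet> u} * prob {x \<in> space P. t \<le> x \<bullet> u} \<le>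
      (prob {x \<in> space P. (s + t) / 2 \<le> x \<bullet> u})\<^sup>2"
      using volume_pos by (simp add: P_eq H_def power_divide power2_eq_square divide_right_mono)
  qed (use mean_zero[OF assms] in auto)
  then show ?thesis by (simp add: mean_abs_def)
qed

text \<open>With this ratio the \<open>d\<close> exceptional sets in the union bound have total mass \<open>1/32\<close>, half of the mass
  that a half-space is known to have.\<close>

definition box_ratio :: real where "box_ratio = 32 * card W"

definition moment_box :: "'a set" where "moment_box = {x. \<forall>b\<in>W. \<bar>x \<bullet> b\<bar> \<le> box_ratio * N b}"

lemma moment_box_borel [measurable]: "moment_box \<in> sets borel"
  unfolding moment_box_def using finW by measurable

lemma box_ratio_pos: "0 < box_ratio"
  using W_nonempty by (simp add: box_ratio_def card_gt_0_iff)

lemma outside_moment_box: "prob (- moment_box) \<le> 1 / 32"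
proof -
  have "- moment_box = (\<Union>b\<in>W. {x \<in> space P. box_ratio * expectation (\<lambda>x. \<bar>x \<bullet> b\<bar>) < \<bar>x \<bullet> b\<bar>})"
    by (auto simp: moment_box_def mean_abs_def not_le)
  then have "prob (- moment_box) \<le> (\<Sum>b\<in>W. prob {x \<in> space P. box_ratio * expectation (\<lambda>x. \<bar>x \<bullet> b\<bar>) < \<bar>x \<bullet> b\<bar>})"
    using finite_measure_subadditive_finite[OF finW, of "\<lambda>b. {x \<in> space P. box_ratio * expectation (\<lambda>x. \<bar>x \<bullet> b\<bar>) < \<bar>x \<bullet> b\<bar>}"]
    by (auto simp: image_subset_iff)
  also have "\<dots> \<le> (\<Sum>b\<in>W. 1 / box_ratio)"
    by (intro sum_mono markov_relative_to_mean_abs box_ratio_pos integrable_inner)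
  also have "\<dots> = 1 / 32" using W_nonempty by (simp add: box_ratio_def)
  finally show ?thesis .
qed

lemma emeasure_fibre: "emeasure (basis_measure E) {y. x + y \<in> K} = ennreal (fibre_volume x)"
proof -
  have "{y. x + y \<in> K} = (\<lambda>z. z - x) ` K" by force
  then have "bounded {y. x + y \<in> K}"
    using bounded_translation[OF compact_imp_bounded[OF K_compact], of "-x"] by simp
  then show ?thesis
    using emeasure_basis_measure_bounded[OF orthE]
    by (simp add: fibre_volume_def emeasure_eq_ennreal_measure less_top)
qed

lemma fibre_volume_nonneg [simp]: "0 \<le> fibre_volume x" by (simp add: fibre_volume_def)

lemma fibre_volume_midpoint: "fibre_volume x * fibre_volume y \<le> (fibre_volume ((1/2) *\<^sub>R (x + y)))\<^sup>2"
proof -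
  have "emeasure (basis_measure E) {z. x + z \<in> K} * emeasure (basis_measure E) {z. y + z \<in> K}
    \<le> (emeasure (basis_measure E) {z. (1/2) *\<^sub>R (x + y) + z \<in> K})\<^sup>2"
  proof (rule brunn_minkowski_midpoint)
    fix a b assume "a \<in> {z. x + z \<in> K}" "b \<in> {z. y + z \<in> K}"
    then have "(1/2) *\<^sub>R (x + a) + (1/2) *\<^sub>R (y + b) \<in> K"
      by (intro convexD[OF K_convex]) auto
    then show "(1/2) *\<^sub>R (a + b) \<in> {z. (1/2) *\<^sub>R (x + y) + z \<in> K}"
      by (simp add: scaleR_add_right algebra_simps)
  qed auto
  then show ?thesis by (simp add: emeasure_fibre ennreal_power flip: ennreal_mult)
qed

lemma fibre_volume_bounded: obtains s where "0 \<le> s" "\<And>x. x \<in> span W \<Longrightarrow> fibre_volume x \<le> s"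
proof -
  obtain r where r: "\<And>x. x \<in> K \<Longrightarrow> norm x \<le> r"
    using compact_imp_bounded[OF K_compact] unfolding bounded_iff by blast
  have meas: "cball (0::'a) r \<in> sets borel" by (simp add: borel_closed)
  have "fibre_volume x \<le> measure (basis_measure E) (cball 0 r)" if "x \<in> span W" for x
  proof -
    have "emeasure (basis_measure E) {y. x + y \<in> K} \<le> emeasure (basis_measure E) (cball 0 r)"
    proof (rule emeasure_mono_AE)
      show "AE y in basis_measure E. y \<in> {y. x + y \<in> K} \<longrightarrow> y \<in> cball 0 r"
        using AE_basis_measure_span[OF orthE]
      proof eventually_elim
        case (elim y)
        have "(norm y)\<^sup>2 \<le> (norm (x + y))\<^sup>2"
          using inner_orthogonal_parts[OF that elim]
          by (simp add: power2_norm_eq_inner inner_add_left inner_add_right inner_commute)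
        then show ?case using r[of "x + y"] by (auto dest: power2_le_imp_le)
      qed
    qed (use meas in auto)
    then show ?thesis
      using emeasure_basis_measure_bounded[OF orthE bounded_cball[of 0 r]]
      by (simp add: emeasure_fibre emeasure_eq_ennreal_measure less_top)
  qed
  then show ?thesis using that measure_nonneg by blast
qed

text \<open>A set on whose fibres \<open>fibre_volume\<close> is at most \<open>s\<close> has, within the box, at most \<open>s\<close> times the
  volume of the box, and only \<open>1/32\<close> of the total mass is outside the box.\<close>

lemma mass_bound:
  assumes [measurable]: "D \<in> sets borel" and "0 \<le> s"
    and D: "\<And>x y. x \<in> span W \<Longrightarrow> y \<in> span E \<Longrightarrow> x + y \<in> D \<Longrightarrow> fibre_volume x \<le> s"
  shows "measure \<mu> K * (prob D - 1 / 32) \<le> s * (\<Prod>b\<in>W. 2 * (box_ratio * N b))"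
proof -
  have N_nonneg: "0 \<le> box_ratio * N b" for b
    using box_ratio_pos by (simp add: mean_abs_def)
  let ?X = "K \<inter> (D \<inter> moment_box)"
  have "emeasure \<mu> ?X = (\<integral>\<^sup>+x. (\<integral>\<^sup>+y. indicator ?X (x + y) \<partial>basis_measure E) \<partial>basis_measure W)"
    using nn_integral_basis_measure_Un[OF orthW orthE disj, of "indicator ?X"] by simp
  also have "\<dots> \<le> (\<integral>\<^sup>+x. ennreal s * indicator moment_box x \<partial>basis_measure W)"
    using AE_basis_measure_span[OF orthW]
  proof (intro nn_integral_mono_AE, eventually_elim)
    case (elim x)
    show ?case
    proof (cases "x \<in> moment_box \<and> fibre_volume x \<le> s")
      case True
      have "(\<integral>\<^sup>+y. indicator ?X (x + y) \<partial>basis_measure E) \<le> (\<integral>\<^sup>+y. indicator {y. x + y \<in> K} y \<partial>basis_measure E)"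
        by (intro nn_integral_mono) (auto split: split_indicator)
      also have "\<dots> = ennreal (fibre_volume x)" by (simp add: emeasure_fibre)
      also have "\<dots> \<le> ennreal s * indicator moment_box x" using True by (simp add: ennreal_leI)
      finally show ?thesis .
    next
      case False
      have "(\<integral>\<^sup>+y. indicator ?X (x + y) \<partial>basis_measure E) = (\<integral>\<^sup>+y. 0 \<partial>basis_measure E)"
        using AE_basis_measure_span[OF orthE]
      proof (intro nn_integral_cong_AE, eventually_elim)
        case (elim y)
        have "(x + y) \<bullet> b = x \<bullet> b" if "b \<in> W" for b
          using inner_orthogonal_parts[of b y] \<open>y \<in> span E\<close> that by (simp add: inner_add_left span_base)
        then have "x + y \<in> moment_box \<longleftrightarrow> x \<in> moment_box" by (simp add: moment_box_def)
        then show ?case using False D[OF \<open>x \<in> span W\<close> \<open>y \<in> span E\<close>] by (auto split: split_indicator)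
      qed
      then show ?thesis by simp
    qed
  qed
  also have "\<dots> = ennreal s * emeasure (basis_measure W) moment_box"
    by (simp add: nn_integral_cmult_indicator)
  also have "\<dots> = ennreal (s * (\<Prod>b\<in>W. 2 * (box_ratio * N b)))"
    using emeasure_basis_measure_box[OF orthW N_nonneg] \<open>0 \<le> s\<close> N_nonneg
    by (simp add: moment_box_def ennreal_mult prod_nonneg)
  finally have "measure \<mu> ?X \<le> s * (\<Prod>b\<in>W. 2 * (box_ratio * N b))"
    unfolding measure_def
    by (intro enn2real_leI mult_nonneg_nonneg prod_nonneg \<open>0 \<le> s\<close> ballI
      mult_nonneg_nonneg[OF _ N_nonneg]) simp_all
  moreover have "prob D - 1 / 32 \<le> prob (D \<inter> moment_box)"
  proof -
    have "prob D \<le> prob ((D \<inter> moment_box) \<union> (- moment_box))"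
      by (intro finite_measure_mono) auto
    also have "\<dots> \<le> prob (D \<inter> moment_box) + prob (- moment_box)"
      by (intro measure_Un_le) auto
    finally show ?thesis using outside_moment_box by simp
  qed
  moreover have "measure \<mu> K * prob (D \<inter> moment_box) = measure \<mu> ?X"
    using volume_pos by (simp add: P_eq)
  ultimately show ?thesis
    using volume_pos by (smt (verit) mult_left_mono)
qed

text \<open>If \<open>N b\<close> vanished the box would be a null set, although it contains most of the mass.\<close>

lemma mean_abs_pos: assumes "b \<in> W" shows "0 < N b"
proof (rule ccontr)
  assume "\<not> 0 < N b"
  then have "N b = 0" by (simp add: mean_abs_def order.antisym not_less)
  then have 0: "(\<Prod>b\<in>W. 2 * (box_ratio * N b)) = 0" using assms by (auto intro!: prod_zero)
  obtain s where "0 \<le> s" "\<And>x. x \<in> span W \<Longrightarrow> fibre_volume x \<le> s" by (rule fibre_volume_bounded) blast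
  then have "measure \<mu> K * (prob UNIV - 1 / 32) \<le> s * 0"
    using mass_bound[of UNIV s] 0 by simp
  moreover have "prob UNIV = 1" using prob_space by simp
  ultimately show False using volume_pos by simp
qed

text \<open>The level \<open>s\<^sub>0\<close> of the introduction: a region inside the box in which the fibres are smaller than
  this has at most \<open>1/64\<close> of the mass.\<close>

definition base_level :: real where
  "base_level = measure \<mu> K / (64 * (\<Prod>b\<in>W. 2 * (box_ratio * N b)))"

lemma box_volume_pos: "0 < (\<Prod>b\<in>W. 2 * (box_ratio * N b))"
  using mean_abs_pos box_ratio_pos by (intro prod_pos) auto

lemma base_level_pos: "0 < base_level"
  using volume_pos box_volume_pos by (simp add: base_level_def)

text \<open>Otherwise \<open>x0\<close> could be separated from the superlevel set at \<open>base_level\<close>, and the resulting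
  half-space would contain at least \<open>1/16\<close> of the mass although all its fibres are small.\<close>

lemma fibre_volume_lower:
  assumes x0: "x0 \<in> span W" and small: "\<And>u. u \<in> span W \<Longrightarrow> x0 \<bullet> u \<le> N u / 4"
  shows "base_level \<le> fibre_volume x0"
proof (rule ccontr)
  assume "\<not> base_level \<le> fibre_volume x0"
  define A where "A = {x \<in> span W. base_level \<le> fibre_volume x}"
  have "compact A"
  proof (rule compact_subset_span_orthonormal[OF orthW])
    have "A = span W \<inter> {x. ennreal base_level \<le> emeasure (basis_measure E) {y. x + y \<in> K}}"
      by (auto simp: A_def emeasure_fibre)
    then show "closed A"
      using closed_superlevel_fibre_volume[OF orthE K_compact] closed_span_orthonormal[OF orthW] by auto
    obtain r where r: "\<And>x. x \<in> K \<Longrightarrow> norm x \<le> r"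
      using compact_imp_bounded[OF K_compact] unfolding bounded_iff by blast
    have "norm x \<le> r" if "x \<in> A" for x
    proof -
      have "emeasure (basis_measure E) {y. x + y \<in> K} \<noteq> 0"
        using that base_level_pos by (simp add: A_def emeasure_fibre)
      then have "\<not> (AE y in basis_measure E. x + y \<notin> K)"
        using AE_iff_measurable[of "{y. x + y \<in> K}" "basis_measure E" "\<lambda>y. x + y \<notin> K"] by simp
      then obtain y where y: "y \<in> span E" "x + y \<in> K"
        using AE_basis_measure_span[OF orthE] by (meson eventually_mono)
      have "(norm x)\<^sup>2 \<le> (norm (x + y))\<^sup>2"
        using inner_orthogonal_parts[of x y] y that
        by (simp add: A_def power2_norm_eq_inner inner_add_left inner_add_right inner_commute)
      then show ?thesis using r[OF y(2)] by (auto dest: power2_le_imp_le)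
    qed
    then show "bounded A" unfolding bounded_iff by blast
  qed (auto simp: A_def)
  moreover have "(1/2) *\<^sub>R (x + y) \<in> A" if "x \<in> A" "y \<in> A" for x y
  proof -
    have "base_level\<^sup>2 \<le> fibre_volume x * fibre_volume y"
      unfolding power2_eq_square using that base_level_pos by (intro mult_mono) (auto simp: A_def)
    then have "base_level\<^sup>2 \<le> (fibre_volume ((1/2) *\<^sub>R (x + y)))\<^sup>2"
      using fibre_volume_midpoint order_trans by blast
    then have "base_level \<le> fibre_volume ((1/2) *\<^sub>R (x + y))"
      by (rule power2_le_imp_le) simp
    then show ?thesis using that by (auto simp: A_def intro: span_scale span_add)
  qed
  moreover have "x0 \<notin> A" using \<open>\<not> base_level \<le> fibre_volume x0\<close> by (simp add: A_def)
  ultimately obtain u where u: "u \<in> span W" "\<And>y. y \<in> A \<Longrightarrow> y \<bullet> u < x0 \<bullet> u"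
    using midpoint_convex_separation[of A x0 "span W"] x0 by (auto simp: A_def)
  define D where "D = {x. N u / 4 \<le> x \<bullet> u}"
  have "measure \<mu> K * (prob D - 1 / 32) \<le> base_level * (\<Prod>b\<in>W. 2 * (box_ratio * N b))"
  proof (rule mass_bound)
    show "D \<in> sets borel" unfolding D_def by measurable
    fix x y assume "x \<in> span W" "y \<in> span E" "x + y \<in> D"
    then have "x0 \<bullet> u \<le> x \<bullet> u"
      using inner_orthogonal_parts[OF u(1), of y] small[OF u(1)] by (simp add: D_def inner_add_left)
    then have "x \<notin> A" using u(2)[of x] by fastforce
    then show "fibre_volume x \<le> base_level" using \<open>x \<in> span W\<close> by (simp add: A_def)
  qed (use base_level_pos in simp)
  also have "\<dots> = measure \<mu> K * (1 / 64)"
  proof -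
    have "v / (64 * q) * q = v * (1 / 64)" if "0 < q" for v q :: real using that by simp
    then show ?thesis unfolding base_level_def using box_volume_pos by blast
  qed
  finally have "prob D - 1 / 32 \<le> 1 / 64" using volume_pos by simp
  then show False using halfspace_mass[OF u(1)] by (simp add: D_def)
qed

lemma fibre_volume_axis:
  assumes "b \<in> W" "\<bar>t\<bar> \<le> 1 / 2 ^ (card W + 2)"
  shows "base_level \<le> fibre_volume ((t * N b) *\<^sub>R b)"
proof (rule fibre_volume_lower)
  show "(t * N b) *\<^sub>R b \<in> span W" using assms by (intro span_scale span_base)
  fix u assume u: "u \<in> span W"
  have "((t * N b) *\<^sub>R b) \<bullet> u \<le> \<bar>t\<bar> * (\<bar>u \<bullet> b\<bar> * N b)"
    using mean_abs_pos[OF assms(1)] abs_ge_self[of "t * (u \<bullet> b)"]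
    by (simp add: inner_commute abs_mult mult_right_mono mult.assoc[symmetric] mult.commute[of _ "N b"])
  also have "\<dots> \<le> 1 / 2 ^ (card W + 2) * (2 ^ card W * N u)"
  proof (rule mult_mono)
    show "\<bar>u \<bullet> b\<bar> * N b \<le> 2 ^ card W * N u" by (rule diagonal[OF u assms(1)])
  qed (use assms(2) in \<open>auto simp: mean_abs_def\<close>)
  also have "\<dots> = N u / 4" by simp
  finally show "((t * N b) *\<^sub>R b) \<bullet> u \<le> N u / 4" .
qed

lemma fibre_volume_0: "base_level \<le> fibre_volume 0"
proof -
  obtain b where "b \<in> W" using W_nonempty by blast
  then show ?thesis using fibre_volume_axis[of b 0] by simp
qed

text \<open>Log-concavity on the segment from \<open>0\<close> to \<open>x\<close>, at dyadic points only, by repeated halving.\<close>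

lemma fibre_volume_contract:
  "fibre_volume 0 * (fibre_volume x / fibre_volume 0) powr (1 / 2 ^ k) \<le> fibre_volume ((1 / 2 ^ k) *\<^sub>R x)"
proof (induction k)
  case 0
  then show ?case using fibre_volume_0 base_level_pos by simp
next
  case (Suc k)
  let ?r = "fibre_volume x / fibre_volume 0"
  have pos0: "0 < fibre_volume 0" using fibre_volume_0 base_level_pos by simp
  have "(?r powr (1 / 2 ^ Suc k))\<^sup>2 = ?r powr (1 / 2 ^ k)"
    by (simp add: power2_eq_square flip: powr_add)
  then have "(fibre_volume 0 * ?r powr (1 / 2 ^ Suc k))\<^sup>2 = fibre_volume 0 * (fibre_volume 0 * ?r powr (1 / 2 ^ k))"
    by (simp add: power_mult_distrib) (simp add: power2_eq_square)
  also have "\<dots> \<le> fibre_volume 0 * fibre_volume ((1 / 2 ^ k) *\<^sub>R x)"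
    using Suc pos0 by (intro mult_left_mono) auto
  also have "\<dots> \<le> (fibre_volume ((1/2) *\<^sub>R (0 + (1 / 2 ^ k) *\<^sub>R x)))\<^sup>2"
    by (rule fibre_volume_midpoint)
  finally have "(fibre_volume 0 * ?r powr (1 / 2 ^ Suc k))\<^sup>2 \<le> (fibre_volume ((1 / 2 ^ Suc k) *\<^sub>R x))\<^sup>2"
    by simp
  then show ?case by (rule power2_le_imp_le) simp
qed

text \<open>The factor by which the fibre volume can drop below its value at \<open>0\<close> after contraction by
  \<open>2 ^ d\<close>. The exponent makes the product of \<open>d\<close> such factors no worse than a single \<open>base_level / f 0\<close>.\<close>

definition section_loss :: real where
  "section_loss = (base_level / fibre_volume 0) powr (1 / 2 ^ card W)"

lemma fibre_volume_near_0:
  assumes "b \<in> W" "\<bar>t\<bar> \<le> 1 / 2 ^ (2 * card W + 2)"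
  shows "fibre_volume 0 * section_loss \<le> fibre_volume ((t * N b) *\<^sub>R b)"
proof -
  \<comment> \<open>this point, before contraction by \<open>2 ^ card W\<close>, is still covered by the lower bound\<close>
  let ?x = "((2 ^ card W * t) * N b) *\<^sub>R b"
  have pos0: "0 < fibre_volume 0" using fibre_volume_0 base_level_pos by simp
  have "\<bar>2 ^ card W * t\<bar> \<le> 2 ^ card W * (1 / 2 ^ (2 * card W + 2))"
    unfolding abs_mult using assms(2) by (intro mult_mono) auto
  also have "(2::real) ^ (2 * card W + 2) = 2 ^ card W * 2 ^ (card W + 2)"
    by (simp flip: power_add)
  also have "2 ^ card W * (1 / (2 ^ card W * 2 ^ (card W + 2))) = (1 / 2 ^ (card W + 2) :: real)"
    by (simp only: times_divide_eq_right mult_1_right) simp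
  finally have "base_level \<le> fibre_volume ?x" by (rule fibre_volume_axis[OF assms(1)])
  then have "fibre_volume 0 * section_loss \<le> fibre_volume 0 * (fibre_volume ?x / fibre_volume 0) powr (1 / 2 ^ card W)"
    unfolding section_loss_def using pos0 base_level_pos
    by (intro mult_left_mono powr_mono2 divide_right_mono) auto
  also have "\<dots> \<le> fibre_volume ((1 / 2 ^ card W) *\<^sub>R ?x)" by (rule fibre_volume_contract)
  finally show ?thesis by simp
qed

lemma section_lower:
  assumes "b \<in> W"
  shows "N b * (fibre_volume 0 * section_loss) / 2 ^ (2 * card W + 1) \<le> measure (basis_measure (insert b E)) K"
proof -
  let ?c = "fibre_volume 0 * section_loss" and ?a = "N b / 2 ^ (2 * card W + 2)"
  have b: "orthonormal {b}" "{b} \<inter> E = {}" "orthonormal (insert b E)"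
    using orthonormal_subset[OF orth] assms disj by auto
  have Nb: "0 < N b" using mean_abs_pos[OF assms] .
  have c: "0 \<le> ?c" by (simp add: section_loss_def)
  have "ennreal (2 * ?a * ?c) = (\<integral>\<^sup>+t. ennreal ?c * indicator {- ?a..?a} t \<partial>lborel)"
    using Nb c by (simp add: nn_integral_cmult_indicator ennreal_mult[symmetric] mult.commute)
  also have "\<dots> \<le> (\<integral>\<^sup>+t. ennreal (fibre_volume (t *\<^sub>R b)) \<partial>lborel)"
  proof (rule nn_integral_mono)
    fix t
    show "ennreal ?c * indicator {- ?a..?a} t \<le> ennreal (fibre_volume (t *\<^sub>R b))"
    proof (cases "t \<in> {- ?a..?a}")
      case True
      then have "\<bar>t / N b\<bar> \<le> 1 / 2 ^ (2 * card W + 2)"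
        using Nb by (auto simp: abs_le_iff field_simps)
      from fibre_volume_near_0[OF assms this] show ?thesis
        using Nb True by (simp add: ennreal_leI)
    qed simp
  qed
  also have "\<dots> = (\<integral>\<^sup>+x. (\<integral>\<^sup>+y. indicator K (x + y) \<partial>basis_measure E) \<partial>basis_measure {b})"
  proof -
    interpret Em: sigma_finite_measure "basis_measure E" by (rule sigma_finite_basis_measure[OF orthE])
    have inner: "(\<integral>\<^sup>+y. indicator K (x + y) \<partial>basis_measure E) = ennreal (fibre_volume x)" for x
    proof -
      have "(\<integral>\<^sup>+y. indicator K (x + y) \<partial>basis_measure E) = (\<integral>\<^sup>+y. indicator {y. x + y \<in> K} y \<partial>basis_measure E)"
        by (intro nn_integral_cong) (auto split: split_indicator)
      then show ?thesis by (simp add: emeasure_fibre)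
    qed
    have "(\<lambda>x. \<integral>\<^sup>+y. indicator K (x + y) \<partial>basis_measure E) \<in> borel_measurable borel"
      by measurable
    from nn_integral_basis_measure_singleton[OF this] show ?thesis by (simp only: inner)
  qed
  also have "\<dots> = emeasure (basis_measure (insert b E)) K"
    using nn_integral_basis_measure_Un[OF b(1) orthE b(2), of "indicator K"] by simp
  finally have "2 * ?a * ?c \<le> measure (basis_measure (insert b E)) K"
    using emeasure_basis_measure_bounded[OF b(3) compact_imp_bounded[OF K_compact]] c Nb
    by (simp add: emeasure_eq_ennreal_measure less_top)
  then show ?thesis by (simp add: mult.assoc)
qed

theorem volume_le_prod_sections:
  "measure \<mu> K * measure (basis_measure E) K ^ (card W - 1) \<le>
    64 * (64 * real (card W)) ^ card W * 2 ^ ((2 * card W + 1) * card W) *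
    (\<Prod>b\<in>W. measure (basis_measure (insert b E)) K)"
proof -
  let ?d = "card W"
  define S where "S = fibre_volume 0"
  have S: "S = measure (basis_measure E) K" by (simp add: S_def fibre_volume_def)
  have Spos: "0 < S" using fibre_volume_0 base_level_pos by (simp add: S_def)
  have d: "0 < ?d" using W_nonempty by (simp add: card_gt_0_iff)
  let ?N = "\<Prod>b\<in>W. N b" and ?q = "2 ^ (2 * ?d + 1) :: real"
  have Npos: "0 < ?N" using mean_abs_pos by (intro prod_pos) auto
  have loss: "base_level / S \<le> section_loss ^ ?d"
  proof -
    have r: "0 < base_level / S" "base_level / S \<le> 1"
      using base_level_pos fibre_volume_0 Spos by (auto simp: S_def)
    have "real ?d / 2 ^ ?d \<le> 1" by (simp add: of_nat_less_two_power less_imp_le)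
    then have "(base_level / S) powr 1 \<le> (base_level / S) powr (real ?d / 2 ^ ?d)"
      using r by (intro powr_mono') auto
    also have "\<dots> = section_loss ^ ?d"
      using powr_realpow[of section_loss ?d, symmetric] base_level_pos Spos
      by (simp add: section_loss_def S_def powr_powr)
    finally show ?thesis using base_level_pos Spos by simp
  qed
  have floor: "base_level * ?N = measure \<mu> K / (64 * (64 * real ?d) ^ ?d)"
  proof -
    have "(\<Prod>b\<in>W. 2 * (box_ratio * N b)) = (\<Prod>b\<in>W. (64 * real ?d) * N b)"
      by (intro prod.cong) (simp_all add: box_ratio_def)
    also have "\<dots> = (64 * real ?d) ^ ?d * ?N" by (simp add: prod.distrib power_mult_distrib)
    finally have eq: "(\<Prod>b\<in>W. 2 * (box_ratio * N b)) = (64 * real ?d) ^ ?d * ?N" .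
    have "v / (64 * (q * m)) * m = v / (64 * q)" if "0 < m" for v q m :: real using that by simp
    then show ?thesis unfolding base_level_def eq using Npos by blast
  qed
  have "measure \<mu> K * S ^ (?d - 1) / (64 * (64 * real ?d) ^ ?d * ?q ^ ?d) = S ^ (?d - 1) * (base_level * ?N) / ?q ^ ?d"
    unfolding floor by simp
  also have "\<dots> = S ^ ?d * (base_level / S) * ?N / ?q ^ ?d"
    using d Spos by (cases ?d) (auto simp: field_simps)
  also have "\<dots> \<le> S ^ ?d * section_loss ^ ?d * ?N / ?q ^ ?d"
    using loss Spos Npos by (intro divide_right_mono mult_right_mono mult_left_mono) auto
  also have "\<dots> = (\<Prod>b\<in>W. N b * (S * section_loss) / ?q)"
    by (simp add: prod.distrib prod_dividef power_mult_distrib)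
  also have "\<dots> \<le> (\<Prod>b\<in>W. measure (basis_measure (insert b E)) K)"
  proof (rule prod_mono, intro conjI)
    fix b assume b: "b \<in> W"
    show "0 \<le> N b * (S * section_loss) / ?q"
      using mean_abs_pos[OF b] Spos by (simp add: section_loss_def)
    show "N b * (S * section_loss) / ?q \<le> measure (basis_measure (insert b E)) K"
      using section_lower[OF b] by (simp add: S_def)
  qed
  finally have "measure \<mu> K * S ^ (?d - 1) \<le>
      (\<Prod>b\<in>W. measure (basis_measure (insert b E)) K) * (64 * (64 * real ?d) ^ ?d * ?q ^ ?d)"
    using d by (subst (asm) pos_divide_le_eq) auto
  then show ?thesis
    by (simp only: S power_mult mult.commute[of "\<Prod>b\<in>W. measure (basis_measure (insert b E)) K"])
qed

end

section \<open>Sections of convex bodies in coordinate space\<close>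

lemma orthonormal_axes: "orthonormal (axis_fseq ` {..<n})"
  by (auto simp: orthonormal_def pairwise_def orthogonal_def)

lemma subspace_Rn: "subspace (Rn n)"
  by (simp flip: span_axes)

lemma orthonormal_Un_orth_in:
  assumes W: "orthonormal W" "span W = H" and E: "orthonormal E" "span E = orth_in n H" and H: "H \<subseteq> Rn n"
  shows "orthonormal (W \<union> E)" "W \<inter> E = {}" "span (W \<union> E) = Rn n"
proof -
  have WH: "W \<subseteq> H" and EH: "E \<subseteq> orth_in n H" using W E span_base by blast+
  have orth: "w \<bullet> e = 0" if "w \<in> W" "e \<in> E" for w e
    using that WH EH by (auto simp: orth_in_def orthogonal_comp_def orthogonal_def)
  then have orth': "e \<bullet> w = 0" if "w \<in> W" "e \<in> E" for w e
    using that by (metis inner_commute)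
  show "orthonormal (W \<union> E)"
    using W(1) E(1) orth orth'
    unfolding orthonormal_def pairwise_def orthogonal_def by auto
  show "W \<inter> E = {}"
  proof (rule ccontr)
    assume "W \<inter> E \<noteq> {}"
    then obtain w where "w \<in> W" "w \<in> E" by blast
    then show False using orth[of w w] W(1) by (auto simp: orthonormal_def)
  qed
  show "span (W \<union> E) = Rn n"
  proof (rule antisym)
    show "span (W \<union> E) \<subseteq> Rn n"
      using WH EH H by (intro span_minimal subspace_Rn) (auto simp: orth_in_def)
    show "Rn n \<subseteq> span (W \<union> E)"
    proof
      fix x assume x: "x \<in> Rn n"
      define p where "p = (\<Sum>b\<in>W. (x \<bullet> b) *\<^sub>R b)"
      have p: "p \<in> span W" unfolding p_def by (intro span_sum span_scale span_base)
      have "orthogonal (x - p) y" if "y \<in> span W" for y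
        using inner_sum_orthonormal[OF W(1), of _ "\<lambda>b. x \<bullet> b"] that
        by (intro orthogonal_to_span[OF that]) (auto simp: orthogonal_def inner_diff_left p_def)
      then have "x - p \<in> orth_in n H"
        using x p W(2) H subspace_diff[OF subspace_Rn, of x n p]
        by (auto simp: orth_in_def orthogonal_comp_def orthogonal_commute)
      then have "x - p \<in> span E" by (simp add: E(2))
      then have "p + (x - p) \<in> span (W \<union> E)" using p unfolding span_Un by blast
      then show "x \<in> span (W \<union> E)" by simp
    qed
  qed
qed

lemma section_volume_span:
  fixes B :: "'a::{real_inner,second_countable_topology} set"
  assumes "orthonormal B" "K \<in> sets borel"
  shows "section_volume K (span B) = measure (basis_measure B) K"
proof -
  have "span B \<in> sets borel" using closed_span_orthonormal[OF assms(1)] by (rule borel_closed)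
  then have "emeasure (basis_measure B) (K \<inter> span B) = emeasure (basis_measure B) K"
    using assms AE_basis_measure_span[OF assms(1)] by (intro emeasure_eq_AE) (auto elim: eventually_mono)
  then show ?thesis
    by (simp add: section_volume_def lborel_of_eq_basis_measure[OF assms(1) refl] measure_def)
qed

lemma span_plus_span_singleton: "span E + span {w} = span (insert w E)"
proof -
  have "insert w E = E \<union> {w}" by simp
  then show ?thesis by (simp only: span_Un) (auto simp: set_plus_def)
qed

lemma convex_body_borel: "convex_body n K \<Longrightarrow> K \<in> sets borel"
  by (auto simp: convex_body_def compact_imp_closed)

lemma inner_eq_sum_coord: "u \<in> Rn n \<Longrightarrow> x \<bullet> u = (\<Sum>i<n. coord x i * coord u i)"
  by (subst inner_commute, subst inner_fseq_superset[of "{..<n}"])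
     (auto simp: Rn_def not_less[symmetric] mult.commute)

text \<open>The barycentre is defined coordinatewise, and every linear functional on \<open>\<real>\<^sup>n\<close> is a combination of
  the first \<open>n\<close> coordinates.\<close>

lemma centered_mean_zero:
  assumes K: "convex_body n K" "centered n K" and B: "orthonormal B" "span B = Rn n"
    and pos: "emeasure (basis_measure B) K \<noteq> 0" and u: "u \<in> Rn n"
  shows "(LINT x|uniform_measure (basis_measure B) K. x \<bullet> u) = 0"
proof -
  let ?\<mu> = "basis_measure B"
  have bdd: "bounded K" using K(1) by (auto simp: convex_body_def compact_imp_bounded)
  have [measurable]: "K \<in> sets borel" using convex_body_borel[OF K(1)] .
  have fin: "emeasure ?\<mu> K \<noteq> \<infinity>"
    using emeasure_basis_measure_bounded[OF B(1) bdd] by simp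
  interpret P: prob_space "uniform_measure ?\<mu> K" using pos fin by (rule prob_space_uniform_measure)
  have \<mu>: "lborel_of (Rn n) = ?\<mu>" by (rule lborel_of_eq_basis_measure[OF B])
  have nz: "measure ?\<mu> K \<noteq> 0" using pos fin by (simp add: measure_def enn2real_eq_0_iff)
  have meas [measurable]: "(\<lambda>x. coord x i) \<in> borel_measurable borel" for i
    by (simp flip: inner_axis_fseq)
  have "(\<Sum>i<n. (LINT x:K|?\<mu>. coord x i) *\<^sub>R axis_fseq i) = 0"
    using K(2) nz by (simp add: centered_def barycentre_def \<mu>)
  moreover have "coord (\<Sum>i<n. c i *\<^sub>R axis_fseq i) j = c j" if "j < n" for c j
    using that by (simp add: coord_sum if_distrib[of "(*) _"] cong: if_cong)
  ultimately have "(LINT x:K|?\<mu>. coord x j) = 0" if "j < n" for j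
    using that by (metis zero_fseq.rep_eq)
  then have 0: "(LINT x|uniform_measure ?\<mu> K. coord x j) = 0" if "j < n" for j
    using that pos fin by (subst integral_uniform_measure) auto
  obtain r where r: "\<And>x. x \<in> K \<Longrightarrow> norm x \<le> r" using bdd unfolding bounded_iff by blast
  have int: "integrable (uniform_measure ?\<mu> K) (\<lambda>x. coord x i)" for i
  proof (rule P.integrable_const_bound[of _ r])
    have "\<bar>coord x i\<bar> \<le> r" if "x \<in> K" for x
      using Cauchy_Schwarz_ineq2[of x "axis_fseq i"] r[OF that] by simp
    then show "AE x in uniform_measure ?\<mu> K. norm (coord x i) \<le> r"
      by (intro AE_uniform_measureI) auto
  qed measurable
  have "(LINT x|uniform_measure ?\<mu> K. x \<bullet> u) = (LINT x|uniform_measure ?\<mu> K. (\<Sum>i<n. coord x i * coord u i))"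
    using u by (simp add: inner_eq_sum_coord)
  also have "\<dots> = (\<Sum>i<n. (LINT x|uniform_measure ?\<mu> K. coord x i) * coord u i)"
    using int by (subst Bochner_Integration.integral_sum) auto
  also have "\<dots> = 0" using 0 by simp
  finally show ?thesis .
qed

text \<open>Since \<open>d \<le> 2 ^ (d - 1)\<close>, the left-hand side is at most a power of \<open>2\<close> whose exponent is quadratic in
  \<open>d\<close>, and for \<open>d \<ge> 2\<close> any quadratic polynomial in \<open>d\<close> is dominated by a multiple of \<open>d * (d - 1)\<close>.\<close>

lemma constant_bound:
  assumes "2 \<le> d"
  shows "64 * (64 * real d) ^ d * 2 ^ ((2 * d + 1) * d) \<le> (2 ^ 15) ^ (d * (d - 1)) * real d powr (real d / 2)"
proof -
  obtain k where d: "d = k + 2" using assms by (metis add.commute le_Suc_ex)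
  have "real (k + 2) \<le> 2 ^ (k + 1)" by (induction k) auto
  then have "real d ^ d \<le> (2 ^ (d - 1)) ^ d" unfolding d by (intro power_mono) simp_all
  then have "64 * (64 * real d) ^ d * 2 ^ ((2 * d + 1) * d) \<le> 2 ^ 6 * ((2 ^ 6) ^ d * (2 ^ (d - 1)) ^ d) * 2 ^ ((2 * d + 1) * d)"
    by (simp add: power_mult_distrib)
  also have "\<dots> = 2 ^ (6 + (6 * d + (d - 1) * d) + (2 * d + 1) * d)"
    by (simp only: power_add power_mult)
  also have "\<dots> \<le> 2 ^ (15 * (d * (d - 1)))"
    by (intro power_increasing) (auto simp: d algebra_simps)
  also have "\<dots> = (2 ^ 15) ^ (d * (d - 1)) * 1" by (simp add: power_mult)
  also have "\<dots> \<le> (2 ^ 15) ^ (d * (d - 1)) * real d powr (real d / 2)"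
    using assms by (intro mult_left_mono ge_one_powr_ge_zero) auto
  finally show ?thesis .
qed

text \<open>A body of volume zero is treated separately, since the uniform distribution on it is not defined. For
  \<open>d = 1\<close> the constant on the right is \<open>1\<close>, so that the estimate has to be replaced by the equality of
  the two volumes.\<close>

lemma section_inequality:
  assumes d: "1 \<le> d" and K: "convex_body n K" "centered n K"
    and H: "subspace H" "H \<subseteq> Rn n" "dim H = d"
    and E: "orthonormal E" "span E = orth_in n H"
  shows "\<exists>W. orthonormal W \<and> span W = H \<and>
    section_volume K (Rn n) * section_volume K (orth_in n H) ^ (d - 1)
         \<le> (2 ^ 15) ^ (d * (d - 1)) * real d powr (real d / 2) *
           (\<Prod>w\<in>W. section_volume K (orth_in n H + span {w}))"
proof -
  have Kb: "K \<in> sets borel" by (rule convex_body_borel[OF K(1)])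
  have cpt: "compact K" "convex K" using K(1) by (auto simp: convex_body_def)
  obtain W0 where W0: "orthonormal W0" "span W0 = H"
    using orthonormal_basis_subspace_exists[of H "axis_fseq ` {..<n}"] H by (auto simp: span_axes)
  define \<mu> where "\<mu> = basis_measure (W0 \<union> E)"
  define P where "P = uniform_measure \<mu> K"
  have nonneg: "0 \<le> section_volume K V" for V by (simp add: section_volume_def)
  have vol: "section_volume K (Rn n) = measure \<mu> K"
    using section_volume_span[OF orthonormal_Un_orth_in(1)[OF W0 E H(2)] Kb]
      orthonormal_Un_orth_in(3)[OF W0 E H(2)] by (simp add: \<mu>_def)
  consider "measure \<mu> K = 0" | "d = 1" | "measure \<mu> K \<noteq> 0" "2 \<le> d" using d by linarith
  then show ?thesis
  proof cases
    case 1
    then show ?thesis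
      using W0 nonneg by (intro exI[of _ W0]) (auto simp: vol intro!: mult_nonneg_nonneg prod_nonneg)
  next
    case 2
    have "card W0 = 1" using orthonormal_card[OF W0(1)] W0(2) H(3) 2 by simp
    then obtain w where w: "W0 = {w}" by (auto simp: card_1_singleton_iff)
    have "orth_in n H + span {w} = Rn n"
      using orthonormal_Un_orth_in(3)[OF W0 E H(2)] by (simp add: w flip: E(2)) (simp add: span_plus_span_singleton)
    then show ?thesis using W0 2 by (intro exI[of _ W0]) (simp add: w)
  next
    case 3
    have fin: "emeasure \<mu> K \<noteq> \<infinity>"
      using emeasure_basis_measure_bounded[OF orthonormal_Un_orth_in(1)[OF W0 E H(2)] compact_imp_bounded[OF cpt(1)]]
      by (simp add: \<mu>_def)
    have pos: "emeasure \<mu> K \<noteq> 0" using 3(1) by (auto simp: measure_def)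
    have P: "prob_space P" unfolding P_def using pos fin by (rule prob_space_uniform_measure)
    have setsP: "sets P = sets borel" by (simp add: P_def \<mu>_def)
    obtain r where r: "\<And>x. x \<in> K \<Longrightarrow> norm x \<le> r"
      using compact_imp_bounded[OF cpt(1)] unfolding bounded_iff by blast
    have "AE x in P. norm x \<le> r"
      unfolding P_def using Kb r by (intro AE_uniform_measureI) (auto simp: \<mu>_def)
    note N = mean_abs_add[OF P setsP this] mean_abs_scaleR[OF P setsP this] mean_abs_le_norm[OF P setsP this]
    obtain W where W: "orthonormal W" "span W = H"
      and diag: "\<And>u b. u \<in> H \<Longrightarrow> b \<in> W \<Longrightarrow> \<bar>u \<bullet> b\<bar> * mean_abs P b \<le> 2 ^ card W0 * mean_abs P u"
      using seminorm_almost_diagonal_basis[of "mean_abs P", OF N W0(1)] W0(2) by auto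
    note WE = orthonormal_Un_orth_in[OF W E H(2)]
    have card: "card W = d" "card W0 = d"
      using orthonormal_card[OF W(1)] orthonormal_card[OF W0(1)] W W0 H(3) by auto
    have \<mu>: "\<mu> = basis_measure (W \<union> E)"
      unfolding \<mu>_def using WE orthonormal_Un_orth_in[OF W0 E H(2)] by (intro basis_measure_unique) auto
    interpret centered_body W E K
    proof
      show "u \<in> span W \<Longrightarrow> (LINT x|uniform_measure (basis_measure (W \<union> E)) K. x \<bullet> u) = 0" for u
        using centered_mean_zero[OF K WE(1,3)] pos W(2) H(2) by (auto simp: \<mu>)
      show "u \<in> span W \<Longrightarrow> b \<in> W \<Longrightarrow>
        \<bar>u \<bullet> b\<bar> * mean_abs (uniform_measure (basis_measure (W \<union> E)) K) b \<le>
        2 ^ card W * mean_abs (uniform_measure (basis_measure (W \<union> E)) K) u" for u b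
        using diag W(2) card by (simp add: P_def \<mu>)
      show "W \<noteq> {}" using card 3(2) by auto
    qed (use WE cpt pos \<mu> in auto)
    have sections: "section_volume K (orth_in n H + span {w}) = measure (basis_measure (insert w E)) K"
      if "w \<in> W" for w
    proof -
      have "orthonormal (insert w E)" by (rule orthonormal_subset[OF WE(1)]) (use that in auto)
      from section_volume_span[OF this Kb] show ?thesis by (simp add: span_plus_span_singleton flip: E(2))
    qed
    have fibre: "section_volume K (orth_in n H) = measure (basis_measure E) K"
      using section_volume_span[OF E(1) Kb] E(2) by simp
    have "section_volume K (Rn n) * section_volume K (orth_in n H) ^ (d - 1) \<le>
      64 * (64 * real d) ^ d * 2 ^ ((2 * d + 1) * d) * (\<Prod>w\<in>W. section_volume K (orth_in n H + span {w}))"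
      using volume_le_prod_sections by (simp add: vol fibre sections card \<mu>)
    also have "\<dots> \<le> (2 ^ 15) ^ (d * (d - 1)) * real d powr (real d / 2) *
           (\<Prod>w\<in>W. section_volume K (orth_in n H + span {w}))"
      by (intro mult_right_mono constant_bound 3 prod_nonneg nonneg ballI)
    finally show ?thesis using W by blast
  qed
qed

theorem theorem1p4:
  shows "\<exists>C::real. \<forall>n d :: nat. \<forall>K H :: fseq set.
    1 \<le> d \<longrightarrow> d \<le> n \<longrightarrow>
    convex_body n K \<longrightarrow> centered n K \<longrightarrow>
    subspace H \<longrightarrow> H \<subseteq> Rn n \<longrightarrow> dim H = d \<longrightarrow>
    (\<exists>w :: nat \<Rightarrow> fseq.
       inj_on w {1..d} \<and> orthonormal_basis (w ` {1..d}) H \<and>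
       section_volume K (Rn n) * section_volume K (orth_in n H) ^ (d - 1)
         \<le> C ^ (d * (d - 1)) * real d powr (real d / 2) *
           (\<Prod>j = 1..d. section_volume K (orth_in n H + span {w j})))"
proof (intro exI[of _ "2 ^ 15"] allI impI)
  fix n d :: nat and K H :: "fseq set"
  assume d: "1 \<le> d" and K: "convex_body n K" "centered n K"
    and H: "subspace H" "H \<subseteq> Rn n" "dim H = d"
  have "subspace (orth_in n H)"
    unfolding orth_in_def by (intro subspace_inter subspace_orthogonal_comp subspace_Rn)
  then obtain E where E: "orthonormal E" "span E = orth_in n H"
    using orthonormal_basis_subspace_exists[of "orth_in n H" "axis_fseq ` {..<n}"]
    by (auto simp: span_axes orth_in_def)
  obtain W where W: "orthonormal W" "span W = H"
    and ineq: "section_volume K (Rn n) * section_volume K (orth_in n H) ^ (d - 1)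
         \<le> (2 ^ 15) ^ (d * (d - 1)) * real d powr (real d / 2) *
           (\<Prod>w\<in>W. section_volume K (orth_in n H + span {w}))"
    using section_inequality[OF d K H E] by blast
  have "card W = d" using orthonormal_card[OF W(1)] W(2) H(3) by simp
  then obtain w where w: "bij_betw w {1..d} W"
    using ex_bij_betw_nat_finite_1[of W] W(1) by auto
  have "(\<Prod>w\<in>W. section_volume K (orth_in n H + span {w})) =
    (\<Prod>j = 1..d. section_volume K (orth_in n H + span {w j}))"
    using prod.reindex_bij_betw[OF w, of "\<lambda>w. section_volume K (orth_in n H + span {w})"] by simp
  then show "\<exists>w :: nat \<Rightarrow> fseq.
       inj_on w {1..d} \<and> orthonormal_basis (w ` {1..d}) H \<and>
       section_volume K (Rn n) * section_volume K (orth_in n H) ^ (d - 1)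
         \<le> (2 ^ 15) ^ (d * (d - 1)) * real d powr (real d / 2) *
           (\<Prod>j = 1..d. section_volume K (orth_in n H + span {w j}))"
    using w W ineq
    by (intro exI[of _ w]) (auto simp: bij_betw_def orthonormal_basis_def orthonormal_def)
qed

end
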